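(* Let $G$ be one of the groups $\mathcal{R},\mathcal{G}_l,\mathcal{G}_r,\mathcal{G}_{lr}$. Let $A=[a_{ij}]\in \mathfrak{m}\cdot M_{m,n}$ and let $o:=\mathrm{ord}(A)$. If there is some integer $k\ge 0$ such that $$\mathfrak{m}^{k+2}\cdot M_{m,n}\subset \mathfrak{m}\cdot \widetilde T_A(GA),$$ then $A$ is $G$ $(2k-o+2)$-determined.
   Context: $K$ is a field of arbitrary characteristic, $R=K[[x_1,\ldots,x_s]]$ is the formal power series ring with maximal ideal $\mathfrak{m}$, and $M_{m,n}$ is the $R$-module of $m\times n$ matrices with entries in $R$. Groups and actions: $\mathcal{R}=\mathrm{Aut}(R)$ is the group of $K$-algebra automorphisms of $R$; $\mathcal{G}_l=GL(m,R)\rtimes\mathcal{R}$, $\mathcal{G}_r=GL(n,R)\rtimes\mathcal{R}$, $\mathcal{G}_{lr}=(GL(m,R)\times GL(n,R))\rtimes\mathcal{R}$. They act on $M_{m,n}$ by $\phi(A)=[\phi(a_{ij})]$, $U\cdot\phi(A)$, $\phi(A)\cdot V$, $U\cdot\phi(A)\cdot V$, respectively, for $\phi\in\mathcal{R}$, $U\in GL(m,R)$, $V\in GL(n,R)$. $GA$ denotes the orbit of $A$; $A,B$ are $G$-equivalent if $B\in GA$. $A$ is $G$ $k$-determined if every $B\in M_{m,n}$ with $B-A\in\mathfrak{m}^{k+1}\cdot M_{m,n}$ is $G$-equivalent to $A$. Order: for $0\neq f\in R$, $\mathrm{ord}(f)$ is the maximal integer $l$ with $f\in\mathfrak{m}^l$,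 and $\mathrm{ord}(0)=\infty$; $\mathrm{ord}(A)=\min_{i,j}\mathrm{ord}(a_{ij})$. Tangent images: let $E_{m,pq}$ (resp. $E_{n,hl}$) be the $m\times m$ (resp. $n\times n$) matrix with $1$ at place $(p,q)$ (resp. $(h,l)$) and $0$ elsewhere, and $\frac{\partial A}{\partial x_\nu}=[\frac{\partial a_{ij}}{\partial x_\nu}]$. Let $\langle E_{m,pq}\cdot A\rangle$, $\langle A\cdot E_{n,hl}\rangle$, $\langle\frac{\partial A}{\partial x_\nu}\rangle$ be the $R$-submodules of $M_{m,n}$ generated by all $E_{m,pq}A$ ($1\le p,q\le m$), all $AE_{n,hl}$ ($1\le h,l\le n$), and all $\frac{\partial A}{\partial x_\nu}$ ($1\le\nu\le s$), respectively. Then $\widetilde T_A(\mathcal{R}A)=\mathfrak{m}\langle\frac{\partial A}{\partial x_\nu}\rangle$, $\widetilde T_A(\mathcal{G}_lA)=\langle E_{m,pq}A\rangle+\mathfrak{m}\langle\frac{\partial A}{\partial x_\nu}\rangle$, $\widetilde T_A(\mathcal{G}_rA)=\langle AE_{n,hl}\rangle+\mathfrak{m}\langle\frac{\partial A}{\partial x_\nu}\rangle$, $\widetilde T_A(\mathcal{G}_{lr}A)=\langle E_{m,pq}A\rangle+\langle AE_{n,hl}\rangle+\mathfrak{m}\langle\frac{\partial A}{\partial x_\nu}\rangle$. *)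

theory Defs
  imports "HOL-Analysis.Analysis"
begin

section \<open>Formal power series in finitely many variables\<close>

text \<open>
  A power series in the variables \<open>x\<^sub>\<nu>\<close>, \<open>\<nu>\<close> ranging over the (nonempty) finite type \<open>'s\<close>, is the family
  of its coefficients, indexed by the exponent vectors in \<open>nat ^ 's\<close>.
\<close>

typedef ('k, 's) mps = "UNIV :: (nat ^ 's::finite \<Rightarrow> 'k) set"
  morphisms mps_nth Abs_mps
  by simp

lemma mps_nth_Abs [simp]: "mps_nth (Abs_mps f) = f"
  by (simp add: Abs_mps_inverse)

lemma mps_eqI: "(\<And>e. mps_nth f e = mps_nth g e) \<Longrightarrow> f = g"
  by (metis mps_nth_inject ext)

lemma finite_exponent_pairs: "finite {(d, e). d + e = (c :: nat ^ 's::finite)}"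
proof -
  let ?S = "{d :: nat ^ 's. \<forall>i. d $ i \<le> c $ i}"
  have "?S \<subseteq> vec_lambda ` (PiE UNIV (\<lambda>i. {..c $ i}))"
  proof
    fix d assume "d \<in> ?S"
    then have "d = vec_lambda (vec_nth d)" "vec_nth d \<in> PiE UNIV (\<lambda>i. {..c $ i})" by auto
    then show "d \<in> vec_lambda ` (PiE UNIV (\<lambda>i. {..c $ i}))" by (rule image_eqI)
  qed
  then have "finite ?S" by (rule finite_subset) (auto intro!: finite_PiE)
  moreover have "{(d, e). d + e = c} \<subseteq> ?S \<times> ?S" by auto
  ultimately show ?thesis by (meson finite_SigmaI finite_subset)
qed

instantiation mps :: (comm_ring_1, finite) comm_ring_1
begin

definition "0 = Abs_mps (\<lambda>_. 0)"
definition "1 = Abs_mps (\<lambda>e. if e = 0 then 1 else 0)"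
definition "f + g = Abs_mps (\<lambda>e. mps_nth f e + mps_nth g e)"
definition "- f = Abs_mps (\<lambda>e. - mps_nth f e)"
definition "f - g = Abs_mps (\<lambda>e. mps_nth f e - mps_nth g e)"
definition "f * g = Abs_mps (\<lambda>c. \<Sum>(d, e) \<in> {(d, e). d + e = c}. mps_nth f d * mps_nth g e)"

instance
proof
  fix a b c :: "('a, 'b) mps"
  show "a * b * c = a * (b * c)"
  proof (rule mps_eqI)
    fix n
    let ?a = "mps_nth a" and ?b = "mps_nth b" and ?c = "mps_nth c"
    have "mps_nth (a * b * c) n
        = (\<Sum>(u, r) \<in> {(u, r). u + r = n}. \<Sum>(p, q) \<in> {(p, q). p + q = u}. ?a p * ?b q * ?c r)"
      by (simp add: times_mps_def sum_distrib_right case_prod_beta)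
    also have "\<dots> = (\<Sum>((u, r), (p, q)) \<in> (SIGMA (u, r) : {(u, r). u + r = n}. {(p, q). p + q = u}).
        ?a p * ?b q * ?c r)"
      by (subst sum.Sigma[symmetric]) (auto simp: finite_exponent_pairs case_prod_beta)
    also have "\<dots> = (\<Sum>((p, v), (q, r)) \<in> (SIGMA (p, v) : {(p, v). p + v = n}. {(q, r). q + r = v}).
        ?a p * (?b q * ?c r))"
      by (rule sum.reindex_bij_witness[where
            i = "\<lambda>((p, v), (q, r)). ((p + q, r), (p, q))" and
            j = "\<lambda>((u, r), (p, q)). ((p, q + r), (q, r))"])
         (auto simp: ac_simps)
    also have "\<dots> = (\<Sum>(p, v) \<in> {(p, v). p + v = n}. \<Sum>(q, r) \<in> {(q, r). q + r = v}. ?a p * (?b q * ?c r))"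
      by (subst sum.Sigma[symmetric]) (auto simp: finite_exponent_pairs case_prod_beta)
    also have "\<dots> = mps_nth (a * (b * c)) n"
      by (simp add: times_mps_def sum_distrib_left case_prod_beta)
    finally show "mps_nth (a * b * c) n = mps_nth (a * (b * c)) n" .
  qed
  show "a * b = b * a"
    unfolding times_mps_def
    by (intro arg_cong[where f = Abs_mps] ext
          sum.reindex_bij_witness[where i = prod.swap and j = prod.swap])
       (auto simp: ac_simps)
  show "1 * a = a"
  proof (rule mps_eqI)
    fix n
    have "mps_nth (1 * a) n
        = (\<Sum>x \<in> {(d, e). d + e = n}. if x = (0, n) then mps_nth a n else 0)"
      unfolding times_mps_def one_mps_def mps_nth_Abs
      by (rule sum.cong) (auto split: if_splits)
    also have "\<dots> = mps_nth a n"
      by (simp add: finite_exponent_pairs)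
    finally show "mps_nth (1 * a) n = mps_nth a n" .
  qed
  show "(a + b) * c = a * c + b * c"
    by (rule mps_eqI)
       (simp add: times_mps_def plus_mps_def case_prod_beta distrib_right sum.distrib)
  show "a + b + c = a + (b + c)" "a + b = b + a" "0 + a = a" "- a + a = 0" "a - b = a + - b"
    by (auto intro!: mps_eqI simp: plus_mps_def zero_mps_def uminus_mps_def minus_mps_def ac_simps)
  have "mps_nth (0 :: ('a, 'b) mps) 0 \<noteq> mps_nth 1 0"
    by (simp add: zero_mps_def one_mps_def)
  then show "(0 :: ('a, 'b) mps) \<noteq> 1" by metis
qed

end

definition mps_const :: "'k::zero \<Rightarrow> ('k, 's::finite) mps" where
  "mps_const c = Abs_mps (\<lambda>e. if e = 0 then c else 0)"

definition mps_deriv :: "'s \<Rightarrow> ('k::semiring_1, 's::finite) mps \<Rightarrow> ('k, 's) mps" where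
  "mps_deriv \<nu> f = Abs_mps (\<lambda>e. of_nat (e $ \<nu> + 1) * mps_nth f (e + axis \<nu> 1))"

definition mps_Aut :: "(('k::comm_ring_1, 's::finite) mps \<Rightarrow> ('k, 's) mps) set" where
  "mps_Aut = {\<phi>. bij \<phi> \<and> (\<forall>f g. \<phi> (f + g) = \<phi> f + \<phi> g) \<and> (\<forall>f g. \<phi> (f * g) = \<phi> f * \<phi> g)
                  \<and> (\<forall>c. \<phi> (mps_const c) = mps_const c)}"


section \<open>Ideals and modules of matrices\<close>

definition mat_scale :: "'r::comm_ring_1 \<Rightarrow> 'r ^ 'n ^ 'm \<Rightarrow> 'r ^ 'n ^ 'm" where
  "mat_scale r A = (\<chi> i j. r * A $ i $ j)"

lemma mat_scale_nth [simp]: "mat_scale r A $ i $ j = r * A $ i $ j"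
  by (simp add: mat_scale_def)

interpretation ring_mod: module "(*) :: 'r::comm_ring_1 \<Rightarrow> 'r \<Rightarrow> 'r"
  by (rule module.intro) (rule distrib_left distrib_right mult.assoc[symmetric] mult_1_left)+

interpretation mat_mod: module "mat_scale :: 'r::comm_ring_1 \<Rightarrow> 'r ^ 'n ^ 'm \<Rightarrow> 'r ^ 'n ^ 'm"
proof
  fix a b :: 'r and x y :: "'r ^ 'n ^ 'm"
  show "mat_scale a (x + y) = mat_scale a x + mat_scale a y"
    by (simp only: vec_eq_iff vector_add_component mat_scale_nth distrib_left) simp
  show "mat_scale (a + b) x = mat_scale a x + mat_scale b x"
    by (simp only: vec_eq_iff vector_add_component mat_scale_nth distrib_right) simp
  show "mat_scale a (mat_scale b x) = mat_scale (a * b) x"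
    by (simp only: vec_eq_iff mat_scale_nth mult.assoc) simp
  show "mat_scale 1 x = x"
    by (simp only: vec_eq_iff mat_scale_nth mult_1_left) simp
qed

text \<open>
  \<open>ring_mod.span S\<close> is the ideal, and \<open>mat_mod.span S\<close> the submodule of the matrix module, generated
  by \<open>S\<close>.
\<close>

definition ideal_prod :: "'r::comm_ring_1 set \<Rightarrow> 'r set \<Rightarrow> 'r set" where
  "ideal_prod I J = ring_mod.span {a * b | a b. a \<in> I \<and> b \<in> J}"

primrec ideal_power :: "'r::comm_ring_1 set \<Rightarrow> nat \<Rightarrow> 'r set" where
  "ideal_power I 0 = UNIV"
| "ideal_power I (Suc l) = ideal_prod I (ideal_power I l)"

definition ideal_smult :: "'r::comm_ring_1 set \<Rightarrow> ('r ^ 'n ^ 'm) set \<Rightarrow> ('r ^ 'n ^ 'm) set" where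
  "ideal_smult I N = mat_mod.span {mat_scale a X | a X. a \<in> I \<and> X \<in> N}"

text \<open>The maximal ideal of the power series ring: the series without constant term.\<close>

definition max_ideal :: "('k::comm_ring_1, 's::finite) mps set" where
  "max_ideal = {f. mps_nth f 0 = 0}"

definition mps_ord :: "('k::comm_ring_1, 's::finite) mps \<Rightarrow> enat" where
  "mps_ord f = (if f = 0 then \<infinity> else enat (GREATEST l. f \<in> ideal_power max_ideal l))"

definition mat_ord :: "('k::comm_ring_1, 's::finite) mps ^ 'n ^ 'm \<Rightarrow> enat" where
  "mat_ord A = Min {mps_ord (A $ i $ j) | i j. True}"


section \<open>Group actions, determinacy and tangent images\<close>

text \<open>
  The constructors name the automorphism group of the ring and its semidirect products with
  the general linear groups acting from the left, from the right, and from both sides.  Each group is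
  represented through its orbits, since determinacy involves only these.
\<close>

datatype action_group = Group_R | Group_l | Group_r | Group_lr

definition mat_subst ::
    "('r \<Rightarrow> 'r) \<Rightarrow> 'r ^ 'n ^ 'm \<Rightarrow> 'r ^ 'n ^ 'm" where
  "mat_subst \<phi> A = (\<chi> i j. \<phi> (A $ i $ j))"

fun orbit ::
    "action_group \<Rightarrow> ('k::comm_ring_1, 's::finite) mps ^ 'n ^ 'm \<Rightarrow> (('k, 's) mps ^ 'n ^ 'm) set" where
  "orbit Group_R A = {mat_subst \<phi> A | \<phi>. \<phi> \<in> mps_Aut}"
| "orbit Group_l A = {U ** mat_subst \<phi> A | U \<phi>. invertible U \<and> \<phi> \<in> mps_Aut}"
| "orbit Group_r A = {mat_subst \<phi> A ** V | V \<phi>. invertible V \<and> \<phi> \<in> mps_Aut}"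
| "orbit Group_lr A = {U ** mat_subst \<phi> A ** V | U V \<phi>. invertible U \<and> invertible V \<and> \<phi> \<in> mps_Aut}"

definition determined ::
    "action_group \<Rightarrow> nat \<Rightarrow> ('k::comm_ring_1, 's::finite) mps ^ 'n ^ 'm \<Rightarrow> bool" where
  "determined G k A \<longleftrightarrow>
     (\<forall>B. B - A \<in> ideal_smult (ideal_power max_ideal (k + 1)) UNIV \<longrightarrow> B \<in> orbit G A)"

definition mat_unit :: "'m \<Rightarrow> 'm \<Rightarrow> 'r::zero_neq_one ^ 'm ^ 'm" where
  "mat_unit p q = (\<chi> i j. if i = p \<and> j = q then 1 else 0)"

definition row_span :: "'r::comm_ring_1 ^ 'n ^ 'm \<Rightarrow> ('r ^ 'n ^ 'm) set" where
  "row_span A = mat_mod.span {mat_unit p q ** A | p q. True}"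

definition col_span :: "'r::comm_ring_1 ^ 'n ^ 'm \<Rightarrow> ('r ^ 'n ^ 'm) set" where
  "col_span A = mat_mod.span {A ** mat_unit h l | h l. True}"

definition deriv_span ::
    "('k::comm_ring_1, 's::finite) mps ^ 'n ^ 'm \<Rightarrow> (('k, 's) mps ^ 'n ^ 'm) set" where
  "deriv_span A = mat_mod.span {(\<chi> i j. mps_deriv \<nu> (A $ i $ j)) | \<nu>. True}"

text \<open>The sums below are the sums of submodules, i.e. elementwise sums of sets.\<close>

fun tangent_image ::
    "action_group \<Rightarrow> ('k::comm_ring_1, 's::finite) mps ^ 'n ^ 'm \<Rightarrow> (('k, 's) mps ^ 'n ^ 'm) set" where
  "tangent_image Group_R A = ideal_smult max_ideal (deriv_span A)"
| "tangent_image Group_l A = row_span A + ideal_smult max_ideal (deriv_span A)"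
| "tangent_image Group_r A = col_span A + ideal_smult max_ideal (deriv_span A)"
| "tangent_image Group_lr A = row_span A + col_span A + ideal_smult max_ideal (deriv_span A)"

end

theory Submission
  imports Defs
begin

text \<open>
  Put \<open>a = k + 2 - o \<ge> 1\<close>.  The hypothesis lets one solve \<open>u A + A v + \<Sum>\<^sub>\<nu> \<delta>\<^sub>\<nu> \<partial>A/\<partial>x\<^sub>\<nu> = R\<close> with \<open>u, v\<close> of
  order \<open>a + j\<close> and \<open>\<delta>\<^sub>\<nu>\<close> of order \<open>a + j + 1\<close> whenever \<open>R\<close> has order \<open>o + 2a - 1 + j\<close>.  If \<open>B - A\<close> has order
  \<open>2k - o + 3 = o + 2a - 1\<close>, then \<open>B = (1 + u) \<phi>(A) (1 + v)\<close> with \<open>\<phi>(x\<^sub>\<nu>) = x\<^sub>\<nu> + d\<^sub>\<nu>\<close> is solved by successive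
  approximation: correcting \<open>(u, v, d)\<close> by the solution of the tangent equation for the current error
  leaves an error one order higher, since by Taylor expansion the terms of second order have order at
  least \<open>o + 2a + j\<close>.  The limit \<open>1 + u\<close>, \<open>1 + v\<close>, \<open>\<phi>\<close> is invertible because \<open>a \<ge> 1\<close>.
\<close>

text \<open>This rule of the interpretation reassociates products and so makes \<open>ac_simps\<close> loop.\<close>

declare ring_mod.scale_scale [simp del]

section \<open>Total degree of exponents and the filtration by order\<close>

definition total_degree :: "nat ^ 's::finite \<Rightarrow> nat" where
  "total_degree e = (\<Sum>i\<in>UNIV. e $ i)"

text \<open>The power m^l in coefficient form, see \<open>ideal_power_max_ideal\<close>; orders can
  then be counted without handling generators of ideals.\<close>

definition vanish :: "nat \<Rightarrow> ('k::comm_ring_1, 's::finite) mps set" where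
  "vanish l = {f. \<forall>e. total_degree e < l \<longrightarrow> mps_nth f e = 0}"

lemma mps_nth_simps [simp]:
  "mps_nth 0 e = 0" "mps_nth (f + g) e = mps_nth f e + mps_nth g e"
  "mps_nth (f - g) e = mps_nth f e - mps_nth g e" "mps_nth (- f) e = - mps_nth f e"
  by (simp_all add: zero_mps_def plus_mps_def minus_mps_def uminus_mps_def)

lemma mps_nth_one: "mps_nth 1 e = (if e = 0 then 1 else 0)"
  by (simp add: one_mps_def)

lemma mps_nth_times: "mps_nth (f * g) c = (\<Sum>(d, e) \<in> {(d, e). d + e = c}. mps_nth f d * mps_nth g e)"
  by (simp add: times_mps_def)

lemma mps_nth_sum [simp]: "mps_nth (sum f S) e = (\<Sum>i\<in>S. mps_nth (f i) e)"
  by (induction S rule: infinite_finite_induct) auto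

lemma degree_add [simp]: "total_degree (d + e) = total_degree d + total_degree e"
  by (simp add: total_degree_def sum.distrib)

lemma degree_zero [simp]: "total_degree 0 = 0"
  by (simp add: total_degree_def)

lemma degree_eq_0_iff [simp]: "total_degree e = 0 \<longleftrightarrow> e = 0"
  by (simp add: total_degree_def vec_eq_iff)

lemma degree_axis [simp]: "total_degree (axis \<nu> n) = n"
  by (simp add: total_degree_def axis_def)

text \<open>Keeps the sums over bounded degree in \<open>mps_subst\<close> and
  \<open>klinear_vanish\<close> genuine, since a sum over an infinite set would be 0.\<close>

lemma finite_degree_le [simp]: "finite {e :: nat ^ 's::finite. total_degree e \<le> l}"
proof (rule finite_subset)
  show "{e :: nat ^ 's. total_degree e \<le> l} \<subseteq> vec_lambda ` (PiE UNIV (\<lambda>i. {..l}))"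
  proof
    fix e :: "nat ^ 's" assume "e \<in> {e. total_degree e \<le> l}"
    then have "e $ i \<le> l" for i
      using member_le_sum[of i UNIV "vec_nth e"] by (simp add: total_degree_def)
    then show "e \<in> vec_lambda ` (PiE UNIV (\<lambda>i. {..l}))"
      by (intro image_eqI[of _ _ "vec_nth e"]) auto
  qed
qed (auto intro!: finite_PiE)

text \<open>Splitting off one variable lowers the total degree by one. The order estimates for
  \<open>var_monom\<close> rest on this induction.\<close>

lemma exponent_induct [case_names zero add_axis]:
  fixes e :: "nat ^ 's::finite"
  assumes "P 0" "\<And>e \<nu>. P e \<Longrightarrow> P (e + axis \<nu> 1)"
  shows "P e"
proof (induction "total_degree e" arbitrary: e)
  case 0
  then show ?case using assms(1) by simp
next
  case (Suc n)
  then have "e \<noteq> 0" by auto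
  then obtain \<nu> where \<nu>: "e $ \<nu> > 0" by (auto simp: vec_eq_iff)
  define d where "d = (\<chi> i. e $ i - axis \<nu> 1 $ i)"
  have "e = d + axis \<nu> 1"
    using \<nu> by (auto simp: d_def vec_eq_iff axis_def)
  moreover from this have "P d" using Suc by simp
  ultimately show ?case using assms(2) by simp
qed

lemma vanish_0 [simp]: "0 \<in> vanish l" by (simp add: vanish_def)
lemma vanish_add: "f \<in> vanish l \<Longrightarrow> g \<in> vanish l \<Longrightarrow> f + g \<in> vanish l" by (simp add: vanish_def)
lemma vanish_diff: "f \<in> vanish l \<Longrightarrow> g \<in> vanish l \<Longrightarrow> f - g \<in> vanish l" by (simp add: vanish_def)
lemma vanish_uminus: "f \<in> vanish l \<Longrightarrow> - f \<in> vanish l" by (simp add: vanish_def)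
lemma vanish_sum: "(\<And>i. i \<in> S \<Longrightarrow> f i \<in> vanish l) \<Longrightarrow> sum f S \<in> vanish l"
  by (simp add: vanish_def)
lemma vanish_mono: "f \<in> vanish l \<Longrightarrow> l' \<le> l \<Longrightarrow> f \<in> vanish l'" by (simp add: vanish_def)
lemma vanish_zero_UNIV [simp]: "vanish 0 = UNIV" by (simp add: vanish_def)

lemma vanish_times:
  assumes "f \<in> vanish l" "g \<in> vanish l'"
  shows "f * g \<in> vanish (l + l')"
  unfolding vanish_def
proof (intro CollectI allI impI)
  fix c :: "nat ^ 'b" assume c: "total_degree c < l + l'"
  have "mps_nth f d * mps_nth g e = 0" if "d + e = c" for d e
  proof (cases "total_degree d < l")
    case False
    then have "total_degree e < l'" using c that by auto
    then show ?thesis using assms by (simp add: vanish_def)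
  qed (use assms in \<open>simp add: vanish_def\<close>)
  then show "mps_nth (f * g) c = 0"
    unfolding mps_nth_times by (intro sum.neutral) auto
qed

lemma vanish_times_left: "g \<in> vanish l \<Longrightarrow> f * g \<in> vanish l"
  using vanish_times[of f 0 g l] by simp

text \<open>The m-adic topology is separated: the coefficient at \<open>e\<close> is already 0 for
  \<open>l = Suc (total_degree e)\<close>.\<close>

lemma vanish_all_eq_0:
  assumes "\<And>l. f \<in> vanish l"
  shows "f = 0"
  using assms[of "Suc (total_degree _)"] by (intro mps_eqI) (auto simp: vanish_def)

section \<open>Monomials and the powers of the maximal ideal\<close>

definition mps_monom :: "nat ^ 's::finite \<Rightarrow> ('k::comm_ring_1, 's) mps" where
  "mps_monom e = Abs_mps (\<lambda>c. if c = e then 1 else 0)"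

lemma mps_nth_monom: "mps_nth (mps_monom e) c = (if c = e then 1 else 0)"
  by (simp add: mps_monom_def)

lemma monom_0 [simp]: "mps_monom 0 = 1"
  by (rule mps_eqI) (simp add: mps_nth_monom mps_nth_one)

text \<open>Subtraction of exponents is truncated in each component, so \<open>c - d\<close> alone
  does not tell whether the monomial divides.\<close>

lemma mps_nth_monom_times:
  "mps_nth (mps_monom d * f) c = (if \<exists>e. c = d + e then mps_nth f (c - d) else 0)"
proof (cases "\<exists>e. c = d + e")
  case True
  then obtain e where e: "c = d + e" by blast
  then have "c - d = e" by (simp add: vec_eq_iff)
  have "mps_nth (mps_monom d * f) c = (\<Sum>p \<in> {(d, e). d + e = c}. if p = (d, e) then mps_nth f e else 0)"
    unfolding mps_nth_times by (rule sum.cong) (auto simp: mps_nth_monom e split: if_splits)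
  also have "\<dots> = mps_nth f e" using e by (simp add: finite_exponent_pairs)
  finally show ?thesis using True \<open>c - d = e\<close> by simp
next
  case False
  then have "mps_nth (mps_monom d * f) c = 0"
    unfolding mps_nth_times by (intro sum.neutral) (auto simp: mps_nth_monom)
  then show ?thesis using False by simp
qed

lemma monom_times: "mps_monom d * mps_monom e = mps_monom (d + e)"
  by (rule mps_eqI) (auto simp: mps_nth_monom_times mps_nth_monom vec_eq_iff)

lemma monom_vanish: "mps_monom e \<in> vanish l \<longleftrightarrow> l \<le> total_degree e"
  by (auto simp: vanish_def mps_nth_monom not_less[symmetric])

lemma mps_nth_const_times [simp]: "mps_nth (mps_const a * f) c = a * mps_nth f c"
proof -
  have "mps_nth (mps_const a * f) c
      = (\<Sum>p \<in> {(d, e). d + e = c}. if p = (0, c) then a * mps_nth f c else 0)"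
    unfolding mps_nth_times by (rule sum.cong) (auto simp: mps_const_def split: if_splits)
  also have "\<dots> = a * mps_nth f c" by (simp add: finite_exponent_pairs)
  finally show ?thesis .
qed

text \<open>Serves to identify m^l with \<open>vanish l\<close> and, later, to carry the tangent
  hypothesis on to higher orders.\<close>

lemma vanish_Suc_decomp:
  fixes f :: "('k::comm_ring_1, 's::finite) mps"
  assumes f: "f \<in> vanish (Suc l)"
  obtains g where "\<And>\<nu>. g \<nu> \<in> vanish l" "f = (\<Sum>\<nu>\<in>UNIV. mps_monom (axis \<nu> 1) * g \<nu>)"
proof
  text \<open>Each exponent \<open>c \<noteq> 0\<close> is assigned to one variable \<open>p c\<close> occurring in it.\<close>
  define p where "p e = (SOME \<nu>. e $ \<nu> > 0)" for e :: "nat ^ 's"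
  define g where "g \<nu> = Abs_mps (\<lambda>e. if p (e + axis \<nu> 1) = \<nu> then mps_nth f (e + axis \<nu> 1) else 0)" for \<nu>
  have p: "e $ p e > 0" if "e \<noteq> 0" for e
    unfolding p_def by (rule someI_ex) (use that in \<open>auto simp: vec_eq_iff\<close>)
  show "g \<nu> \<in> vanish l" for \<nu>
    using f by (auto simp: vanish_def g_def)
  show "f = (\<Sum>\<nu>\<in>UNIV. mps_monom (axis \<nu> 1) * g \<nu>)"
  proof (rule mps_eqI)
    fix c :: "nat ^ 's"
    show "mps_nth f c = mps_nth (\<Sum>\<nu>\<in>UNIV. mps_monom (axis \<nu> 1) * g \<nu>) c"
    proof (cases "c = 0")
      case True
      have "mps_nth (mps_monom (axis \<nu> 1) * g \<nu>) c = 0" for \<nu>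
        using True by (auto simp: mps_nth_monom_times vec_eq_iff axis_def)
      then show ?thesis using f True by (simp add: vanish_def)
    next
      case False
      have "mps_nth (mps_monom (axis \<nu> 1) * g \<nu>) c = (if \<nu> = p c then mps_nth f c else 0)" for \<nu>
      proof (cases "c $ \<nu> > 0")
        case True
        then have *: "c = axis \<nu> 1 + (c - axis \<nu> 1)" "c - axis \<nu> 1 + axis \<nu> 1 = c"
          by (auto simp: vec_eq_iff axis_def)
        show ?thesis using * unfolding mps_nth_monom_times g_def mps_nth_Abs
          by (metis (no_types, lifting))
      next
        case False
        then have "\<not> (\<exists>e. c = axis \<nu> 1 + e)" by (auto simp: axis_def)
        moreover have "\<nu> \<noteq> p c" using False p[OF \<open>c \<noteq> 0\<close>] by auto
        ultimately show ?thesis by (simp add: mps_nth_monom_times)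
      qed
      then show ?thesis by simp
    qed
  qed
qed

lemma max_ideal_eq_vanish: "max_ideal = vanish 1"
  by (simp add: max_ideal_def vanish_def)

lemma ideal_power_max_ideal: "ideal_power max_ideal l = vanish l"
proof (induction l)
  case 0
  show ?case by simp
next
  case (Suc l)
  have "ideal_prod (vanish 1) (vanish l) = (vanish (Suc l) :: ('a, 'b) mps set)"
  proof (rule subset_antisym)
    have "a * b \<in> vanish (Suc l)" if "a \<in> vanish 1" "b \<in> vanish l" for a b :: "('a, 'b) mps"
      using vanish_times[OF that] by simp
    then show "ideal_prod (vanish 1) (vanish l) \<subseteq> (vanish (Suc l) :: ('a, 'b) mps set)"
      unfolding ideal_prod_def
      by (intro ring_mod.span_minimal)
         (auto simp: ring_mod.subspace_def vanish_add vanish_times_left)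
    show "vanish (Suc l) \<subseteq> ideal_prod (vanish 1) (vanish l :: ('a, 'b) mps set)"
    proof
      fix f :: "('a, 'b) mps" assume "f \<in> vanish (Suc l)"
      then obtain g where g: "\<And>\<nu>. g \<nu> \<in> vanish l" "f = (\<Sum>\<nu>\<in>UNIV. mps_monom (axis \<nu> 1) * g \<nu>)"
        using vanish_Suc_decomp by blast
      have "mps_monom (axis \<nu> 1) * g \<nu> \<in> ideal_prod (vanish 1) (vanish l)" for \<nu>
        unfolding ideal_prod_def by (rule ring_mod.span_base) (use g(1) in \<open>force simp: monom_vanish\<close>)
      then show "f \<in> ideal_prod (vanish 1) (vanish l)"
        unfolding g(2) ideal_prod_def by (intro ring_mod.span_sum)
    qed
  qed
  then show ?case using Suc by (simp add: max_ideal_eq_vanish)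
qed

section \<open>Filtered linear maps\<close>

definition klinear :: "(('k::comm_ring_1, 's::finite) mps \<Rightarrow> ('k, 's) mps) \<Rightarrow> bool" where
  "klinear L \<longleftrightarrow> (\<forall>f g. L (f + g) = L f + L g) \<and> (\<forall>a f. L (mps_const a * f) = mps_const a * L f)"

lemma klinear_sum:
  assumes "klinear L" shows "L (sum f S) = (\<Sum>i\<in>S. L (f i))"
proof -
  have "L 0 + L 0 = L 0 + 0"
    using assms by (metis add_0 add_0_right klinear_def)
  then have "L 0 = 0" by (simp only: add_left_cancel)
  then show ?thesis
    by (induction S rule: infinite_finite_induct) (use assms in \<open>auto simp: klinear_def\<close>)
qed

text \<open>Filtration-preserving linear maps are m-adically continuous, hence controlled by the monomials.\<close>

lemma klinear_vanish:
  fixes L :: "('k::comm_ring_1, 's::finite) mps \<Rightarrow> ('k, 's) mps"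
  assumes L: "klinear L" and filt: "\<And>l f. f \<in> vanish l \<Longrightarrow> L f \<in> vanish l"
    and mps_monom: "\<And>e. L (mps_monom e) \<in> vanish (total_degree e + t)" and f: "f \<in> vanish l"
  shows "L f \<in> vanish (l + t)"
  unfolding vanish_def
proof (intro CollectI allI impI)
  fix c :: "nat ^ 's" assume c: "total_degree c < l + t"
  let ?S = "{e. total_degree e \<le> total_degree c}"
  \<comment> \<open>The truncation of \<open>f\<close> to degrees at most that of \<open>c\<close>.
    The rest \<open>f - h\<close> has larger order, and so has its image under \<open>L\<close>;
    only \<open>h\<close> contributes to the coefficient at \<open>c\<close>.\<close>
  define h where "h = (\<Sum>e\<in>?S. mps_const (mps_nth f e) * mps_monom e)"
  have "f - h \<in> vanish (Suc (total_degree c))"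
    by (auto simp: h_def vanish_def mps_nth_monom if_distrib cong: if_cong)
  then have "mps_nth (L (f - h)) c = 0"
    using filt by (fastforce simp: vanish_def)
  moreover have "L f = L h + L (f - h)"
    using L unfolding klinear_def by (metis add.commute diff_add_cancel)
  moreover have "mps_nth (L h) c = (\<Sum>e\<in>?S. mps_nth f e * mps_nth (L (mps_monom e)) c)"
    unfolding h_def klinear_sum[OF L] using L by (simp add: klinear_def)
  moreover have "mps_nth f e * mps_nth (L (mps_monom e)) c = 0" for e
  proof (cases "total_degree e < l")
    case False
    then have "mps_nth (L (mps_monom e)) c = 0" using mps_monom[of e] c by (auto simp: vanish_def)
    then show ?thesis by simp
  qed (use f in \<open>simp add: vanish_def\<close>)
  ultimately show "mps_nth (L f) c = 0" by simp
qed

text \<open>If \<open>L\<close> kills all monomials, the gain \<open>t\<close> in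
  \<open>klinear_vanish\<close> is arbitrary, and separatedness gives 0.\<close>

lemma klinear_eq_0:
  assumes "klinear L" "\<And>l f. f \<in> vanish l \<Longrightarrow> L f \<in> vanish l" "\<And>e. L (mps_monom e) = 0"
  shows "L f = 0"
proof (rule vanish_all_eq_0)
  fix l show "L f \<in> vanish l"
    using klinear_vanish[OF assms(1,2), where t = l and l = 0 and f = f] assms(3) by simp
qed

lemma klinear_diff: "klinear L \<Longrightarrow> klinear L' \<Longrightarrow> klinear (\<lambda>f. L f - L' f)"
  by (simp add: klinear_def algebra_simps)

lemma klinear_sum_fun: "(\<And>i. i \<in> S \<Longrightarrow> klinear (L i)) \<Longrightarrow> klinear (\<lambda>f. \<Sum>i\<in>S. L i f)"
  by (simp add: klinear_def sum.distrib sum_distrib_left)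

lemma klinear_times: "klinear L \<Longrightarrow> klinear (\<lambda>f. g * L f)"
  unfolding klinear_def by (metis distrib_left mult.left_commute)

lemma klinear_id: "klinear (\<lambda>f. f)"
  by (simp add: klinear_def)

lemma klinear_times_arg: "klinear L \<Longrightarrow> klinear (\<lambda>f. L (g * f))"
  unfolding klinear_def by (metis distrib_left mult.left_commute)

section \<open>Substitution\<close>

definition var_monom :: "('s \<Rightarrow> ('k::comm_ring_1, 's::finite) mps) \<Rightarrow> nat ^ 's \<Rightarrow> ('k, 's) mps" where
  "var_monom y e = (\<Prod>\<nu>\<in>UNIV. y \<nu> ^ (e $ \<nu>))"

text \<open>Cutting the sum at the degree of \<open>c\<close> makes it finite, so that the map is
  defined, linear and filtered for any \<open>y\<close>. It is the true substitution when all
  \<open>y \<nu>\<close> lie in m, because \<open>var_monom y e\<close> then has order at least the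
  degree of \<open>e\<close>.\<close>

definition mps_subst :: "('s \<Rightarrow> ('k::comm_ring_1, 's::finite) mps) \<Rightarrow> ('k, 's) mps \<Rightarrow> ('k, 's) mps" where
  "mps_subst y f = Abs_mps (\<lambda>c. \<Sum>e | total_degree e \<le> total_degree c. mps_nth f e * mps_nth (var_monom y e) c)"

lemma var_monom_0 [simp]: "var_monom y 0 = 1"
  by (simp add: var_monom_def)

lemma var_monom_add: "var_monom y (d + e) = var_monom y d * var_monom y e"
  by (simp add: var_monom_def power_add prod.distrib)

lemma var_monom_axis [simp]: "var_monom y (axis \<nu> 1) = y \<nu>"
proof -
  have "var_monom y (axis \<nu> 1) = (\<Prod>\<mu>\<in>UNIV. if \<mu> = \<nu> then y \<mu> else 1)"
    unfolding var_monom_def by (rule prod.cong) (auto simp: axis_def)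
  then show ?thesis by simp
qed

lemma var_monom_vanish:
  assumes "\<And>\<nu>. y \<nu> \<in> vanish 1"
  shows "var_monom y e \<in> vanish (total_degree e)"
proof (induction e rule: exponent_induct)
  case (add_axis e \<nu>)
  then show ?case using vanish_times[OF add_axis assms[of \<nu>]]
    by (simp add: var_monom_add del: One_nat_def)
qed simp

lemma klinear_subst: "klinear (mps_subst y)"
  unfolding klinear_def
  by (intro conjI allI mps_eqI) (simp_all add: mps_subst_def distrib_right sum.distrib sum_distrib_left mult.assoc)

lemma subst_diff: "mps_subst y (f - g) = mps_subst y f - mps_subst y g"
  by (rule mps_eqI) (simp add: mps_subst_def sum_subtractf algebra_simps)

lemma subst_vanish: "f \<in> vanish l \<Longrightarrow> mps_subst y f \<in> vanish l"
  by (auto simp: vanish_def mps_subst_def intro!: sum.neutral)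

context
  fixes y :: "'s::finite \<Rightarrow> ('k::comm_ring_1, 's) mps"
  assumes y: "\<And>\<nu>. y \<nu> \<in> vanish 1"
begin

text \<open>Where the cut drops the index \<open>e\<close>, the coefficient of
  \<open>var_monom y e\<close> at \<open>c\<close> is 0 anyway by
  \<open>var_monom_vanish\<close>.\<close>

lemma subst_monom: "mps_subst y (mps_monom e) = var_monom y e"
proof (rule mps_eqI)
  fix c
  have "mps_nth (mps_subst y (mps_monom e)) c
      = (\<Sum>d | total_degree d \<le> total_degree c. if d = e then mps_nth (var_monom y e) c else 0)"
    unfolding mps_subst_def mps_nth_Abs by (rule sum.cong) (auto simp: mps_nth_monom)
  also have "\<dots> = mps_nth (var_monom y e) c"
    using var_monom_vanish[of y e] y by (simp add: vanish_def)
  finally show "mps_nth (mps_subst y (mps_monom e)) c = mps_nth (var_monom y e) c" .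
qed

text \<open>On pairs of monomials this is \<open>var_monom_add\<close>; \<open>klinear_eq_0\<close>
  extends it first in one factor and then, by commutativity, in the other.\<close>

lemma subst_times: "mps_subst y (f * g) = mps_subst y f * mps_subst y g"
proof -
  have *: "mps_subst y (mps_monom e * g) - mps_subst y (mps_monom e) * mps_subst y g = 0" for e g
  proof (rule klinear_eq_0[where L = "\<lambda>g. mps_subst y (mps_monom e * g) - mps_subst y (mps_monom e) * mps_subst y g"])
    show "klinear (\<lambda>g. mps_subst y (mps_monom e * g) - mps_subst y (mps_monom e) * mps_subst y g)"
      by (intro klinear_diff klinear_times klinear_subst
            klinear_times_arg)
    show "mps_subst y (mps_monom e * f) - mps_subst y (mps_monom e) * mps_subst y f \<in> vanish l"
      if "f \<in> vanish l" for l f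
      using that by (intro vanish_diff subst_vanish vanish_times_left)
    show "mps_subst y (mps_monom e * mps_monom e') - mps_subst y (mps_monom e) * mps_subst y (mps_monom e') = 0" for e'
      by (simp add: monom_times subst_monom var_monom_add)
  qed
  have "mps_subst y (g * f) - mps_subst y g * mps_subst y f = 0"
  proof (rule klinear_eq_0[where L = "\<lambda>f. mps_subst y (g * f) - mps_subst y g * mps_subst y f"])
    show "klinear (\<lambda>f. mps_subst y (g * f) - mps_subst y g * mps_subst y f)"
      by (intro klinear_diff klinear_times klinear_subst
            klinear_times_arg)
    show "mps_subst y (g * f) - mps_subst y g * mps_subst y f \<in> vanish l"
      if "f \<in> vanish l" for l f
      using that by (intro vanish_diff subst_vanish vanish_times_left)
    show "mps_subst y (g * mps_monom e) - mps_subst y g * mps_subst y (mps_monom e) = 0" for e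
      using *[of e g] by (simp add: mult.commute)
  qed
  then show ?thesis by (simp add: mult.commute)
qed

lemma subst_const: "mps_subst y (mps_const a) = mps_const a"
proof -
  have "mps_subst y (mps_const a * 1) = mps_const a * mps_subst y 1"
    using klinear_subst[of y] by (simp only: klinear_def)
  also have "mps_subst y 1 = 1" using subst_monom[of 0] by simp
  finally show ?thesis by simp
qed

end

section \<open>Derivations\<close>

text \<open>The vector field with components \<open>\<delta>\<close>; it gives the linear part of a
  substitution when the images of the variables are moved by \<open>\<delta>\<close>.\<close>

definition deriv_along :: "('s \<Rightarrow> ('k::comm_ring_1, 's::finite) mps) \<Rightarrow> ('k, 's) mps \<Rightarrow> ('k, 's) mps" where
  "deriv_along \<delta> f = (\<Sum>\<nu>\<in>UNIV. \<delta> \<nu> * mps_deriv \<nu> f)"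

lemma mps_nth_deriv: "mps_nth (mps_deriv \<nu> f) e = of_nat (e $ \<nu> + 1) * mps_nth f (e + axis \<nu> 1)"
  by (simp add: mps_deriv_def)

lemma klinear_mps_deriv: "klinear (mps_deriv \<nu>)"
  unfolding klinear_def
  by (intro conjI allI mps_eqI) (simp_all add: mps_nth_deriv distrib_left mult.left_commute)

lemma klinear_deriv_along: "klinear (deriv_along \<delta>)"
  unfolding deriv_along_def [abs_def] by (intro klinear_sum_fun klinear_times klinear_mps_deriv)

lemma mps_deriv_vanish: "f \<in> vanish (Suc l) \<Longrightarrow> mps_deriv \<nu> f \<in> vanish l"
  by (auto simp: vanish_def mps_nth_deriv)

text \<open>Differentiation loses at most one order, and the extra 1 in the order of
  \<open>\<delta>\<close> makes up for it. For \<open>l = 0\<close> there is no order to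
  lose.\<close>

lemma times_deriv_vanish:
  assumes "\<delta> \<in> vanish (1 + t)" "f \<in> vanish l"
  shows "\<delta> * mps_deriv \<nu> f \<in> vanish (l + t)"
proof (cases l)
  case 0
  then show ?thesis using assms(1) vanish_times[of \<delta> "1 + t" "mps_deriv \<nu> f" 0]
    by (auto intro: vanish_mono)
next
  case (Suc n)
  then show ?thesis using assms mps_deriv_vanish[of f n \<nu>] vanish_times[of \<delta> "1 + t" "mps_deriv \<nu> f" n]
    by (simp add: add.commute)
qed

lemma deriv_along_vanish:
  assumes "\<And>\<nu>. \<delta> \<nu> \<in> vanish (1 + t)" "f \<in> vanish l"
  shows "deriv_along \<delta> f \<in> vanish (l + t)"
  unfolding deriv_along_def using assms by (intro vanish_sum times_deriv_vanish)

text \<open>Where the truncated \<open>e - axis \<nu> 1\<close> is not a true predecessor of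
  \<open>e\<close>, the factor \<open>of_nat (e $ \<nu>)\<close> is 0.\<close>

lemma mps_deriv_monom:
  "mps_deriv \<nu> (mps_monom e :: ('k::comm_ring_1, 's::finite) mps) = of_nat (e $ \<nu>) * mps_monom (e - axis \<nu> 1)"
proof -
  have "of_nat n * f = mps_const (of_nat n) * f" for n and f :: "('k, 's) mps"
    by (rule mps_eqI, induction n) (simp_all add: distrib_right)
  then show ?thesis
    by (intro mps_eqI, cases "e $ \<nu>") (auto simp: mps_nth_deriv mps_nth_monom vec_eq_iff axis_def simp del: of_nat_Suc)
qed

text \<open>The Leibniz rule for a monomial times a variable, as required by induction over
  exponents.\<close>

lemma mps_deriv_monom_add_axis:
  "mps_deriv \<nu> (mps_monom (e + axis \<mu> 1))
     = mps_monom e * mps_deriv \<nu> (mps_monom (axis \<mu> 1)) + mps_monom (axis \<mu> 1) * mps_deriv \<nu> (mps_monom e)"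
proof (cases "e $ \<nu> = 0")
  case True
  then show ?thesis
    by (cases "\<nu> = \<mu>") (simp_all add: mps_deriv_monom axis_def monom_times vec_eq_iff)
next
  case False
  then have *: "axis \<mu> 1 + (e - axis \<nu> 1) = e + axis \<mu> 1 - axis \<nu> 1"
    by (auto simp: vec_eq_iff axis_def)
  show ?thesis
  proof (cases "\<nu> = \<mu>")
    case True
    have "e + axis \<mu> 1 - axis \<mu> 1 = e" by (simp add: vec_eq_iff)
    then show ?thesis
      using * True unfolding mps_deriv_monom
      by (simp add: monom_times mult.left_commute[of "mps_monom _"] distrib_right axis_def)
  qed (use * in \<open>simp add: mps_deriv_monom monom_times mult.left_commute[of "mps_monom _"] axis_def\<close>)
qed

lemma deriv_along_monom_axis [simp]: "deriv_along \<delta> (mps_monom (axis \<mu> 1)) = \<delta> \<mu>"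
proof -
  have "deriv_along \<delta> (mps_monom (axis \<mu> 1)) = (\<Sum>\<nu>\<in>UNIV. if \<nu> = \<mu> then \<delta> \<mu> else 0)"
    unfolding deriv_along_def by (rule sum.cong) (auto simp: mps_deriv_monom axis_def)
  then show ?thesis by simp
qed

lemma deriv_along_monom_add_axis:
  "deriv_along \<delta> (mps_monom (e + axis \<mu> 1))
     = mps_monom e * \<delta> \<mu> + mps_monom (axis \<mu> 1) * deriv_along \<delta> (mps_monom e)"
proof -
  have "deriv_along \<delta> (mps_monom (e + axis \<mu> 1))
      = mps_monom e * deriv_along \<delta> (mps_monom (axis \<mu> 1)) + mps_monom (axis \<mu> 1) * deriv_along \<delta> (mps_monom e)"
    unfolding deriv_along_def mps_deriv_monom_add_axis
    by (simp only: distrib_left sum.distrib sum_distrib_left mult.left_commute)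
  then show ?thesis by (simp only: deriv_along_monom_axis)
qed

section \<open>Taylor expansion of a perturbed substitution\<close>

abbreviation shift :: "('s \<Rightarrow> ('k::comm_ring_1, 's::finite) mps) \<Rightarrow> 's \<Rightarrow> ('k, 's) mps" where
  "shift d \<equiv> \<lambda>\<nu>. mps_monom (axis \<nu> 1) + d \<nu>"

lemma shift_vanish:
  assumes "\<And>\<nu>. d \<nu> \<in> vanish (1 + a)"
  shows "shift d \<nu> \<in> vanish 1"
  using assms[of \<nu>] by (intro vanish_add) (auto simp: monom_vanish intro: vanish_mono)

text \<open>The variables are exchanged one at a time; each exchange gains order \<open>a\<close>,
  since \<open>d \<mu>\<close> has order \<open>a\<close> above that of the variable.\<close>

lemma var_monom_shift:
  assumes "\<And>\<nu>. d \<nu> \<in> vanish (1 + a)"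
  shows "var_monom (shift d) e - mps_monom e \<in> vanish (total_degree e + a)"
proof (induction e rule: exponent_induct)
  case (add_axis e \<mu>)
  have "var_monom (shift d) (e + axis \<mu> 1) - mps_monom (e + axis \<mu> 1)
      = (var_monom (shift d) e - mps_monom e) * shift d \<mu> + mps_monom e * d \<mu>"
    by (simp add: var_monom_add monom_times[symmetric] algebra_simps del: One_nat_def)
  moreover have "\<dots> \<in> vanish (total_degree e + a + 1)"
    using vanish_times[OF add_axis shift_vanish[OF assms]]
      vanish_times[OF _ assms, of "mps_monom e" "total_degree e" \<mu>]
    by (intro vanish_add) (auto simp: monom_vanish add.assoc add.commute[of a])
  ultimately show ?case by simp
qed simp

lemma subst_shift:
  assumes "\<And>\<nu>. d \<nu> \<in> vanish (1 + a)" "f \<in> vanish l"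
  shows "mps_subst (shift d) f - f \<in> vanish (l + a)"
proof (rule klinear_vanish[where L = "\<lambda>f. mps_subst (shift d) f - f"])
  show "klinear (\<lambda>f. mps_subst (shift d) f - f)"
    by (intro klinear_diff klinear_subst klinear_id)
  show "mps_subst (shift d) f - f \<in> vanish l" if "f \<in> vanish l" for l f
    using that by (intro vanish_diff subst_vanish)
  show "mps_subst (shift d) (mps_monom e) - mps_monom e \<in> vanish (total_degree e + a)" for e
    using var_monom_shift[of d a e, OF assms(1)] shift_vanish[of d a, OF assms(1)]
    by (simp only: subst_monom)
qed (rule assms)

context
  fixes d \<delta> :: "'s::finite \<Rightarrow> ('k::comm_ring_1, 's) mps" and a j :: nat
  assumes d: "\<And>\<nu>. d \<nu> \<in> vanish (1 + a)" and \<delta>: "\<And>\<nu>. \<delta> \<nu> \<in> vanish (1 + (a + j))"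
begin

text \<open>The derivative is taken at the original point and not at \<open>shift d\<close>. The
  error therefore contains mixed products of \<open>d\<close> and \<open>\<delta>\<close>, which
  gain a + (a + j); this is the source of 2a + j. No factorials enter, so the characteristic is
  arbitrary.\<close>

lemma var_monom_taylor:
  "var_monom (shift (\<lambda>\<nu>. d \<nu> + \<delta> \<nu>)) e - var_monom (shift d) e - deriv_along \<delta> (mps_monom e)
     \<in> vanish (total_degree e + (2 * a + j))"
proof (induction e rule: exponent_induct)
  case zero
  have "deriv_along \<delta> (mps_monom 0) = 0"
    unfolding deriv_along_def mps_deriv_monom by simp
  then show ?case by simp
next
  case (add_axis e \<mu>)
  let ?P' = "var_monom (shift (\<lambda>\<nu>. d \<nu> + \<delta> \<nu>)) e" and ?P = "var_monom (shift d) e"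
    and ?D = "deriv_along \<delta> (mps_monom e)" and ?X = "mps_monom (axis \<mu> 1)"
  have D: "?D \<in> vanish (total_degree e + (a + j))"
    using \<delta> by (intro deriv_along_vanish) (auto simp: monom_vanish)
  have "(?P' - ?P - ?D) * (?X + (d \<mu> + \<delta> \<mu>)) \<in> vanish ((total_degree e + (2 * a + j)) + 1)"
    using d[of \<mu>] \<delta>[of \<mu>] add_axis
    by (intro vanish_times vanish_add) (auto simp: monom_vanish intro: vanish_mono)
  moreover have "(?P - mps_monom e) * \<delta> \<mu> \<in> vanish ((total_degree e + a) + (1 + (a + j)))"
    using var_monom_shift[of d a, OF d] \<delta> by (intro vanish_times)
  moreover have "?D * d \<mu> \<in> vanish ((total_degree e + (a + j)) + (1 + a))"
    using D d by (intro vanish_times)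
  moreover have "?D * \<delta> \<mu> \<in> vanish ((total_degree e + (a + j)) + (1 + (a + j)))"
    using D \<delta> by (intro vanish_times)
  ultimately have "(?P' - ?P - ?D) * (?X + (d \<mu> + \<delta> \<mu>)) + (?P - mps_monom e) * \<delta> \<mu> + ?D * d \<mu> + ?D * \<delta> \<mu>
      \<in> vanish (total_degree (e + axis \<mu> 1) + (2 * a + j))"
    by (intro vanish_add) (auto intro: vanish_mono)
  \<comment> \<open>By the Leibniz rule the new error is the old one times the new factor, plus
    cross terms that are each a product of two small quantities.\<close>
  moreover have "(?P' - ?P - ?D) * (?X + (d \<mu> + \<delta> \<mu>)) + (?P - mps_monom e) * \<delta> \<mu> + ?D * d \<mu> + ?D * \<delta> \<mu>
     = ?P' * (?X + (d \<mu> + \<delta> \<mu>)) - ?P * (?X + d \<mu>) - (mps_monom e * \<delta> \<mu> + ?X * ?D)"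
    by (simp add: algebra_simps)
  ultimately show ?case
    by (simp only: var_monom_add deriv_along_monom_add_axis var_monom_axis)
qed

lemma subst_taylor:
  assumes "f \<in> vanish l"
  shows "mps_subst (shift (\<lambda>\<nu>. d \<nu> + \<delta> \<nu>)) f - mps_subst (shift d) f - deriv_along \<delta> f
           \<in> vanish (l + (2 * a + j))"
proof (rule klinear_vanish[where L = "\<lambda>f. mps_subst (shift (\<lambda>\<nu>. d \<nu> + \<delta> \<nu>)) f - mps_subst (shift d) f - deriv_along \<delta> f"])
  let ?L = "\<lambda>f. mps_subst (shift (\<lambda>\<nu>. d \<nu> + \<delta> \<nu>)) f - mps_subst (shift d) f - deriv_along \<delta> f"
  show "klinear ?L"
    by (intro klinear_diff klinear_subst klinear_deriv_along)
  show "?L f \<in> vanish l" if "f \<in> vanish l" for l f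
    using that deriv_along_vanish[of \<delta> "a + j", OF \<delta> that]
    by (intro vanish_diff subst_vanish) (auto intro: vanish_mono)
  show "?L (mps_monom e) \<in> vanish (total_degree e + (2 * a + j))" for e
  proof -
    have "d \<nu> + \<delta> \<nu> \<in> vanish (1 + a)" for \<nu>
      using d[of \<nu>] \<delta>[of \<nu>] by (intro vanish_add) (auto intro: vanish_mono)
    then have "shift (\<lambda>\<nu>. d \<nu> + \<delta> \<nu>) \<nu> \<in> vanish 1" for \<nu>
      by (rule shift_vanish)
    then show ?thesis
      using var_monom_taylor[of e] shift_vanish[of d a, OF d] by (simp add: subst_monom)
  qed
qed (rule assms)

end

section \<open>Completeness\<close>

text \<open>m-adic completeness: the coefficient at \<open>e\<close> no longer changes once
  \<open>total_degree e < w + j\<close>.\<close>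

lemma vanish_limit:
  fixes f :: "nat \<Rightarrow> ('k::comm_ring_1, 's::finite) mps"
  assumes step: "\<And>j. f (Suc j) - f j \<in> vanish (w + j)"
  shows "\<exists>g. \<forall>j. g - f j \<in> vanish (w + j)"
proof -
  have cauchy: "mps_nth (f j') e = mps_nth (f j) e" if "j \<le> j'" "total_degree e < w + j" for j j' e
    using that
  proof (induction rule: dec_induct)
    case (step n)
    then have "mps_nth (f (Suc n) - f n) e = 0"
      using assms[of n] by (auto simp: vanish_def simp del: mps_nth_simps)
    then show ?case using step by simp
  qed simp
  \<comment> \<open>The index \<open>Suc (total_degree e)\<close> is late enough for the coefficient
    at \<open>e\<close>, whatever \<open>w\<close> is.\<close>
  define g where "g = Abs_mps (\<lambda>e. mps_nth (f (Suc (total_degree e))) e)"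
  have "mps_nth g e = mps_nth (f j) e" if "total_degree e < w + j" for e j
    using cauchy[of j "Suc (total_degree e)" e] cauchy[of "Suc (total_degree e)" j e] that
    by (cases "j \<le> Suc (total_degree e)") (auto simp: g_def)
  then show ?thesis by (auto simp: vanish_def)
qed

section \<open>Matrices\<close>

definition mat_vanish :: "nat \<Rightarrow> (('k::comm_ring_1, 's::finite) mps ^ 'n ^ 'm) set" where
  "mat_vanish l = {A. \<forall>i j. A $ i $ j \<in> vanish l}"

lemma mat_vanishD: "A \<in> mat_vanish l \<Longrightarrow> A $ i $ j \<in> vanish l"
  by (simp add: mat_vanish_def)

lemma mat_vanish_0 [simp]: "0 \<in> mat_vanish l"
  by (simp add: mat_vanish_def)

lemma mat_vanish_add: "A \<in> mat_vanish l \<Longrightarrow> B \<in> mat_vanish l \<Longrightarrow> A + B \<in> mat_vanish l"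
  by (simp add: mat_vanish_def vanish_add)

lemma mat_vanish_diff: "A \<in> mat_vanish l \<Longrightarrow> B \<in> mat_vanish l \<Longrightarrow> A - B \<in> mat_vanish l"
  by (simp add: mat_vanish_def vanish_diff)

lemma mat_vanish_diff_commute: "A - B \<in> mat_vanish l \<Longrightarrow> B - A \<in> mat_vanish l"
  using mat_vanish_diff[OF mat_vanish_0, of "A - B" l] by simp

lemma mat_vanish_mono: "A \<in> mat_vanish l \<Longrightarrow> l' \<le> l \<Longrightarrow> A \<in> mat_vanish l'"
  by (auto simp: mat_vanish_def intro: vanish_mono)

lemma mat_vanish_mult:
  "A \<in> mat_vanish l \<Longrightarrow> B \<in> mat_vanish l' \<Longrightarrow> A ** B \<in> mat_vanish (l + l')"
  by (auto simp: mat_vanish_def matrix_matrix_mult_def intro!: vanish_sum vanish_times)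

lemma mat_vanish_mult_left: "B \<in> mat_vanish l \<Longrightarrow> A ** B \<in> mat_vanish l"
  using mat_vanish_mult[of A 0 B l] by (simp add: mat_vanish_def)

lemma mat_vanish_mult_right: "A \<in> mat_vanish l \<Longrightarrow> A ** B \<in> mat_vanish l"
  using mat_vanish_mult[of A l B 0] by (simp add: mat_vanish_def)

lemma mat_vanish_scale: "a \<in> vanish l \<Longrightarrow> A \<in> mat_vanish l' \<Longrightarrow> mat_scale a A \<in> mat_vanish (l + l')"
  by (auto simp: mat_vanish_def intro: vanish_times)

lemma mat_vanish_all_eq_0: "(\<And>l. A \<in> mat_vanish l) \<Longrightarrow> A = 0"
  by (auto simp: mat_vanish_def vec_eq_iff intro: vanish_all_eq_0)

lemma mat_vanish_limit:
  fixes X :: "nat \<Rightarrow> ('k::comm_ring_1, 's::finite) mps ^ 'n ^ 'm"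
  assumes "\<And>j. X (Suc j) - X j \<in> mat_vanish (w + j)"
  shows "\<exists>Y. \<forall>j. Y - X j \<in> mat_vanish (w + j)"
proof -
  have "\<exists>g. \<forall>n. g - X n $ i $ j \<in> vanish (w + n)" for i j
    using assms by (intro vanish_limit) (auto simp: mat_vanish_def)
  then obtain g where "\<And>i j n. g i j - X n $ i $ j \<in> vanish (w + n)" by metis
  then have "\<forall>n. (\<chi> i j. g i j) - X n \<in> mat_vanish (w + n)"
    by (simp add: mat_vanish_def)
  then show ?thesis by blast
qed

text \<open>Banach's fixed point theorem for the m-adic metric: the iterates from 0 converge by
  completeness, and separatedness shows that the limit is fixed.\<close>

lemma mat_contraction_fixed_point:
  fixes T :: "('k::comm_ring_1, 's::finite) mps ^ 'n ^ 'm \<Rightarrow> ('k, 's) mps ^ 'n ^ 'm"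
  assumes T: "\<And>X Y l. X - Y \<in> mat_vanish l \<Longrightarrow> T X - T Y \<in> mat_vanish (Suc l)"
  obtains X where "T X = X"
proof -
  define X where "X n = (T ^^ n) 0" for n
  have "X (Suc n) - X n \<in> mat_vanish (0 + n)" for n
  proof (induction n)
    case (Suc n)
    then show ?case using T[OF Suc] by (simp add: X_def)
  qed (simp add: mat_vanish_def)
  then obtain Y where Y: "\<And>n. Y - X n \<in> mat_vanish n"
    using mat_vanish_limit[of X 0] by auto
  have "T Y - Y = 0"
  proof (rule mat_vanish_all_eq_0)
    fix n
    have "T Y - X (Suc n) \<in> mat_vanish (Suc n)"
      using T[OF Y[of n]] by (simp add: X_def)
    from mat_vanish_diff[OF this Y] show "T Y - Y \<in> mat_vanish n"
      by (auto intro: mat_vanish_mono)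
  qed
  then show thesis using that by simp
qed

section \<open>Invertible matrices and automorphisms near the identity\<close>

lemma matrix_diff_ldistrib: "A ** (B - C) = A ** B - A ** (C :: 'a::comm_ring_1 ^ 'n ^ 'm)"
  by (simp add: matrix_matrix_mult_def vec_eq_iff right_diff_distrib sum_subtractf)

lemma matrix_diff_rdistrib: "(A - B) ** C = A ** C - B ** (C :: 'a::comm_ring_1 ^ 'n ^ 'm)"
  by (simp add: matrix_matrix_mult_def vec_eq_iff left_diff_distrib sum_subtractf)

lemma matrix_add_rdistrib: "(A + B) ** C = A ** C + B ** (C :: 'a::comm_ring_1 ^ 'n ^ 'm)"
  by (simp add: matrix_matrix_mult_def vec_eq_iff distrib_right sum.distrib)

text \<open>The Neumann series in fixed point form: a right inverse solves
  \<open>mat 1 - u ** W = W\<close>, a left inverse \<open>mat 1 - W' ** u = W'\<close>. Both maps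
  are contractions because \<open>u\<close> has order 1, and associativity makes the two inverses
  equal.\<close>

lemma invertible_one_plus:
  fixes u :: "('k::comm_ring_1, 's::finite) mps ^ 'm ^ 'm"
  assumes u: "u \<in> mat_vanish 1"
  shows "invertible (mat 1 + u)"
proof -
  obtain W where "mat 1 - u ** W = W"
  proof (rule mat_contraction_fixed_point[where T = "\<lambda>W. mat 1 - u ** W"])
    fix X Y :: "('k, 's) mps ^ 'm ^ 'm" and l assume "X - Y \<in> mat_vanish l"
    then have *: "u ** (Y - X) \<in> mat_vanish (1 + l)"
      by (intro mat_vanish_mult[OF u] mat_vanish_diff_commute[of X])
    have "mat 1 - u ** X - (mat 1 - u ** Y) = u ** (Y - X)"
      unfolding matrix_diff_ldistrib by simp
    then show "mat 1 - u ** X - (mat 1 - u ** Y) \<in> mat_vanish (Suc l)"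
      using * by simp
  qed
  then have "W + u ** W = mat 1" by (metis diff_add_cancel)
  then have W: "(mat 1 + u) ** W = mat 1" by (simp add: matrix_add_rdistrib)
  obtain W' where "mat 1 - W' ** u = W'"
  proof (rule mat_contraction_fixed_point[where T = "\<lambda>W. mat 1 - W ** u"])
    fix X Y :: "('k, 's) mps ^ 'm ^ 'm" and l assume "X - Y \<in> mat_vanish l"
    then have *: "(Y - X) ** u \<in> mat_vanish (l + 1)"
      by (intro mat_vanish_mult[OF _ u] mat_vanish_diff_commute[of X])
    have "mat 1 - X ** u - (mat 1 - Y ** u) = (Y - X) ** u"
      unfolding matrix_diff_rdistrib by simp
    then show "mat 1 - X ** u - (mat 1 - Y ** u) \<in> mat_vanish (Suc l)"
      using * by simp
  qed
  then have "W' + W' ** u = mat 1" by (metis diff_add_cancel)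
  then have W': "W' ** (mat 1 + u) = mat 1" by (simp add: matrix_add_ldistrib)
  have "W' = W' ** ((mat 1 + u) ** W)" using W by simp
  also have "\<dots> = W" using W' by (simp add: matrix_mul_assoc)
  finally show ?thesis using W W' unfolding invertible_def by blast
qed

text \<open>For \<open>d\<close> of order 2 the substitution changes a series only by terms of
  higher order. So an element of the kernel has arbitrarily high order, and a preimage of
  \<open>g\<close> is a fixed point of the map sending \<open>F\<close> to
  \<open>g + F - mps_subst (shift d) F\<close>.\<close>

lemma subst_shift_Aut:
  fixes d :: "'s::finite \<Rightarrow> ('k::comm_ring_1, 's) mps"
  assumes d: "\<And>\<nu>. d \<nu> \<in> vanish (1 + 1)"
  shows "mps_subst (shift d) \<in> mps_Aut"
proof -
  note y = shift_vanish[of d 1, OF d]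
  note raise = subst_shift[of d 1, OF d]
  have "inj (mps_subst (shift d))"
  proof (rule injI)
    fix f g assume "mps_subst (shift d) f = mps_subst (shift d) g"
    then have 0: "mps_subst (shift d) (f - g) = 0" by (simp add: subst_diff)
    have "f - g \<in> vanish l" for l
    proof (induction l)
      case (Suc l)
      then show ?case using raise[OF Suc] vanish_uminus 0 by fastforce
    qed simp
    then show "f = g" using vanish_all_eq_0[of "f - g"] by simp
  qed
  moreover have "surj (mps_subst (shift d))"
  proof (rule surjI)
    fix g
    \<comment> \<open>Matrices of size one make \<open>mat_contraction_fixed_point\<close>
      applicable to single series.\<close>
    define T :: "('k, 's) mps ^ 1 ^ 1 \<Rightarrow> ('k, 's) mps ^ 1 ^ 1"
      where "T F = (\<chi> i j. g + F $ i $ j - mps_subst (shift d) (F $ i $ j))" for F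
    obtain F where "T F = F"
    proof (rule mat_contraction_fixed_point)
      fix X Y :: "('k, 's) mps ^ 1 ^ 1" and l assume XY: "X - Y \<in> mat_vanish l"
      have "- (mps_subst (shift d) (X $ i $ j - Y $ i $ j) - (X $ i $ j - Y $ i $ j)) \<in> vanish (l + 1)" for i j
        using mat_vanishD[OF XY, of i j] by (intro vanish_uminus raise) simp
      then show "T X - T Y \<in> mat_vanish (Suc l)"
        by (simp add: T_def mat_vanish_def subst_diff algebra_simps)
    qed
    then have "T F $ 1 $ 1 = F $ 1 $ 1" by simp
    then have "g + F $ 1 $ 1 - mps_subst (shift d) (F $ 1 $ 1) = F $ 1 $ 1"
      by (simp only: T_def vec_lambda_beta)
    then have "mps_subst (shift d) (F $ 1 $ 1) = g" by (simp add: algebra_simps)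
    then have "\<exists>f. mps_subst (shift d) f = g" ..
    then show "mps_subst (shift d) (SOME f. mps_subst (shift d) f = g) = g" by (rule someI_ex)
  qed
  ultimately show ?thesis
    using klinear_subst[of "shift d"] y
    by (auto simp: mps_Aut_def bij_def klinear_def subst_times subst_const)
qed

lemma subst_shift_0: "mps_subst (shift (\<lambda>_. 0)) f = f"
proof -
  have "mps_subst (shift (\<lambda>_. 0)) f - f \<in> vanish (0 + l)" for l
    by (rule subst_shift) auto
  then show ?thesis using vanish_all_eq_0[of "mps_subst (shift (\<lambda>_. 0)) f - f"] by simp
qed

section \<open>The submodules m^l M and the order of a matrix\<close>

lemma ideal_smult_vanish_UNIV:
  "ideal_smult (vanish l) UNIV = (mat_vanish l :: (('k::comm_ring_1, 's::finite) mps ^ 'n ^ 'm) set)"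
  (is "?L = ?R")
proof (rule subset_antisym)
  show "?L \<subseteq> ?R"
    unfolding ideal_smult_def
    by (rule mat_mod.span_minimal)
       (auto simp: mat_mod.subspace_def mat_vanish_def vanish_add vanish_times_left
          vanish_times[where l' = 0, simplified])
  show "?R \<subseteq> ?L"
  proof
    fix A :: "('k, 's) mps ^ 'n ^ 'm" assume A: "A \<in> mat_vanish l"
    \<comment> \<open>Rectangular matrix units; \<open>mat_unit\<close> provides square
      ones.\<close>
    define E :: "'m \<Rightarrow> 'n \<Rightarrow> ('k, 's) mps ^ 'n ^ 'm"
      where "E i j = (\<chi> p q. if p = i \<and> q = j then 1 else 0)" for i j
    have "mat_scale (A $ i $ j) (E i j) $ p $ q = (if q = j then if p = i then A $ p $ q else 0 else 0)"
      for i j p q by (simp add: E_def)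
    then have A_eq: "A = (\<Sum>i\<in>UNIV. \<Sum>j\<in>UNIV. mat_scale (A $ i $ j) (E i j))"
      by (simp add: vec_eq_iff del: mat_scale_nth)
    have "(\<Sum>i\<in>UNIV. \<Sum>j\<in>UNIV. mat_scale (A $ i $ j) (E i j)) \<in> ideal_smult (vanish l) UNIV"
      unfolding ideal_smult_def using mat_vanishD[OF A]
      by (intro mat_mod.span_sum mat_mod.span_base) blast
    then show "A \<in> ?L" using A_eq by simp
  qed
qed

text \<open>The \<open>GREATEST\<close> is attained because a nonzero coefficient at
  \<open>e\<close> bounds the admissible \<open>l\<close> by the degree of \<open>e\<close>.\<close>

lemma mps_ord_vanish:
  assumes "f \<noteq> 0"
  obtains l where "mps_ord f = enat l" "f \<in> vanish l"
proof -
  from assms obtain e where e: "mps_nth f e \<noteq> 0" by (metis mps_eqI mps_nth_simps(1))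
  have "f \<in> vanish (GREATEST l. f \<in> vanish l)"
    by (rule GreatestI_nat[of _ 0 "total_degree e"]) (use e in \<open>auto simp: vanish_def not_less[symmetric]\<close>)
  then show thesis using that assms by (simp add: mps_ord_def ideal_power_max_ideal)
qed

lemma mat_ord_vanish:
  fixes A :: "('k::comm_ring_1, 's::finite) mps ^ 'n ^ 'm"
  assumes "A \<noteq> 0"
  obtains l where "mat_ord A = enat l" "A \<in> mat_vanish l"
proof -
  let ?S = "{mps_ord (A $ i $ j) | i j. True}"
  have fin: "finite ?S" 
    by (rule finite_subset[of _ "(\<lambda>(i, j). mps_ord (A $ i $ j)) ` UNIV"]) auto
  from assms obtain i j where ij: "A $ i $ j \<noteq> 0" by (auto simp: vec_eq_iff)
  then obtain n where "mps_ord (A $ i $ j) = enat n" by (rule mps_ord_vanish)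
  then have "mat_ord A \<le> enat n"
    unfolding mat_ord_def using fin by (metis (mono_tags, lifting) CollectI Min_le)
  then obtain l where l: "mat_ord A = enat l" using enat_ile by blast
  have "A $ i $ j \<in> vanish l" for i j
  proof (cases "A $ i $ j = 0")
    case False
    then obtain n where n: "mps_ord (A $ i $ j) = enat n" "A $ i $ j \<in> vanish n" by (rule mps_ord_vanish)
    have "mat_ord A \<le> mps_ord (A $ i $ j)"
      unfolding mat_ord_def using fin by (intro Min_le) auto
    then show ?thesis using n l by (auto intro: vanish_mono)
  qed simp
  then show thesis using that l by (simp add: mat_vanish_def)
qed

section \<open>Infinitesimal and actual perturbations\<close>

definition acts_left :: "action_group \<Rightarrow> bool" where
  "acts_left G \<longleftrightarrow> G = Group_l \<or> G = Group_lr"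

definition acts_right :: "action_group \<Rightarrow> bool" where
  "acts_right G \<longleftrightarrow> G = Group_r \<or> G = Group_lr"

text \<open>A factor missing from the group has its parameter forced to 0, so that all four groups
  are treated by one formula.\<close>

definition gl_params :: "bool \<Rightarrow> nat \<Rightarrow> (('k::comm_ring_1, 's::finite) mps ^ 'm ^ 'm) set" where
  "gl_params b l = (if b then mat_vanish l else {0})"

text \<open>The shift by 1 lets \<open>deriv_mat\<close> raise orders by \<open>l\<close>, just as
  multiplication by a matrix in \<open>mat_vanish l\<close> does.\<close>

definition aut_params :: "nat \<Rightarrow> (('k::comm_ring_1, 's::finite) mps ^ 's) set" where
  "aut_params l = {d. \<forall>\<nu>. d $ \<nu> \<in> vanish (1 + l)}"

text \<open>Infinitesimal group elements of level \<open>l\<close>: level 0 covers the tangent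
  image, level 1 its product with m.\<close>

definition params where
  "params G l = gl_params (acts_left G) l \<times> gl_params (acts_right G) l \<times> aut_params l"

definition deriv_mat ::
    "('k::comm_ring_1, 's::finite) mps ^ 's \<Rightarrow> ('k, 's) mps ^ 'n ^ 'm \<Rightarrow> ('k, 's) mps ^ 'n ^ 'm" where
  "deriv_mat \<delta> A = (\<chi> i j. deriv_along (($) \<delta>) (A $ i $ j))"

text \<open>The linear part of \<open>act A\<close> at the parameter 0.\<close>

fun tangent_vec where
  "tangent_vec A (u, v, \<delta>) = u ** A + A ** v + deriv_mat \<delta> A"

text \<open>A chart of the group at the identity, applied to \<open>A\<close>. Parameters are added
  rather than composed as group elements.\<close>

fun act where
  "act A (u, v, d) = (mat 1 + u) ** mat_subst (mps_subst (shift (($) d))) A ** (mat 1 + v)"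

lemma gl_params_subset: "u \<in> gl_params b l \<Longrightarrow> u \<in> mat_vanish l"
  by (auto simp: gl_params_def split: if_splits)

lemma gl_params_0 [simp]: "0 \<in> gl_params b l"
  by (simp add: gl_params_def)

lemma gl_params_add: "u \<in> gl_params b l \<Longrightarrow> u' \<in> gl_params b l \<Longrightarrow> u + u' \<in> gl_params b l"
  by (auto simp: gl_params_def mat_vanish_add split: if_splits)

lemma gl_params_mono: "u \<in> gl_params b l \<Longrightarrow> l' \<le> l \<Longrightarrow> u \<in> gl_params b l'"
  by (auto simp: gl_params_def mat_vanish_mono split: if_splits)

lemma gl_params_scale: "a \<in> vanish l \<Longrightarrow> u \<in> gl_params b l' \<Longrightarrow> mat_scale a u \<in> gl_params b (l + l')"
  by (auto simp: gl_params_def mat_vanish_scale split: if_splits)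

lemma gl_params_limit:
  fixes u :: "nat \<Rightarrow> ('k::comm_ring_1, 's::finite) mps ^ 'm ^ 'm"
  assumes step: "\<And>j. u (Suc j) - u j \<in> gl_params b (l + j)"
  shows "\<exists>w. \<forall>j. w - u j \<in> gl_params b (l + j)"
proof (cases b)
  case True
  then show ?thesis using step mat_vanish_limit[of u l] by (simp add: gl_params_def)
next
  case False
  then have "u j = u 0" for j
    using step by (induction j) (auto simp: gl_params_def)
  then have "\<forall>j. u 0 - u j \<in> gl_params b (l + j)" by (metis diff_self gl_params_0)
  then show ?thesis ..
qed

lemma aut_params_0 [simp]: "0 \<in> aut_params l"
  by (simp add: aut_params_def)

lemma aut_params_add: "d \<in> aut_params l \<Longrightarrow> d' \<in> aut_params l \<Longrightarrow> d + d' \<in> aut_params l"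
  by (simp add: aut_params_def vanish_add)

lemma aut_params_mono: "d \<in> aut_params l \<Longrightarrow> l' \<le> l \<Longrightarrow> d \<in> aut_params l'"
  by (auto simp: aut_params_def intro: vanish_mono)

lemma aut_params_scale: "a \<in> vanish l \<Longrightarrow> d \<in> aut_params l' \<Longrightarrow> (\<chi> \<nu>. a * d $ \<nu>) \<in> aut_params (l + l')"
  by (auto simp: aut_params_def dest: vanish_times[of a l _ "Suc l'"])

lemma aut_params_limit:
  fixes d :: "nat \<Rightarrow> ('k::comm_ring_1, 's::finite) mps ^ 's"
  assumes step: "\<And>j. d (Suc j) - d j \<in> aut_params (l + j)"
  shows "\<exists>w. \<forall>j. w - d j \<in> aut_params (l + j)"
proof -
  have "\<exists>g. \<forall>j. g - d j $ \<nu> \<in> vanish (Suc l + j)" for \<nu>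
    using step by (intro vanish_limit) (simp add: aut_params_def)
  then obtain g where "\<And>\<nu> j. g \<nu> - d j $ \<nu> \<in> vanish (Suc l + j)" by metis
  then have "\<forall>j. (\<chi> \<nu>. g \<nu>) - d j \<in> aut_params (l + j)" by (simp add: aut_params_def)
  then show ?thesis ..
qed

lemma params_0 [simp]: "0 \<in> params G l"
  by (simp add: params_def zero_prod_def)

lemma params_add: "p \<in> params G l \<Longrightarrow> q \<in> params G l \<Longrightarrow> p + q \<in> params G l"
  by (auto simp: params_def gl_params_add aut_params_add)

lemma params_mono: "p \<in> params G l \<Longrightarrow> l' \<le> l \<Longrightarrow> p \<in> params G l'"
  by (auto simp: params_def gl_params_mono aut_params_mono)

lemma params_limit:
  assumes step: "\<And>j. p (Suc j) - p j \<in> params G (l + j)"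
  shows "\<exists>q. \<forall>j. q - p j \<in> params G (l + j)"
proof -
  have "\<exists>u. \<forall>j. u - fst (p j) \<in> gl_params (acts_left G) (l + j)"
    using step by (intro gl_params_limit) (auto simp: params_def mem_Times_iff)
  moreover have "\<exists>v. \<forall>j. v - fst (snd (p j)) \<in> gl_params (acts_right G) (l + j)"
    using step by (intro gl_params_limit) (auto simp: params_def mem_Times_iff)
  moreover have "\<exists>d. \<forall>j. d - snd (snd (p j)) \<in> aut_params (l + j)"
    using step by (intro aut_params_limit) (auto simp: params_def mem_Times_iff)
  ultimately obtain u v d where
    "\<forall>j. u - fst (p j) \<in> gl_params (acts_left G) (l + j)"
    "\<forall>j. v - fst (snd (p j)) \<in> gl_params (acts_right G) (l + j)"
    "\<forall>j. d - snd (snd (p j)) \<in> aut_params (l + j)"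
    by blast
  then have "\<forall>j. (u, v, d) - p j \<in> params G (l + j)"
    by (auto simp: params_def mem_Times_iff)
  then show ?thesis ..
qed

lemma deriv_mat_add: "deriv_mat (d + d') A = deriv_mat d A + deriv_mat d' A"
  by (simp add: deriv_mat_def deriv_along_def vec_eq_iff distrib_right sum.distrib)

lemma deriv_mat_vanish: "d \<in> aut_params l \<Longrightarrow> A \<in> mat_vanish w \<Longrightarrow> deriv_mat d A \<in> mat_vanish (w + l)"
  by (auto simp: deriv_mat_def aut_params_def mat_vanish_def intro!: deriv_along_vanish)

lemma tangent_vec_add: "tangent_vec A (p + q) = tangent_vec A p + tangent_vec A q"
  by (cases p; cases q)
     (simp add: matrix_add_ldistrib matrix_add_rdistrib deriv_mat_add algebra_simps)

lemma tangent_vec_vanish: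
  assumes "p \<in> params G l" "A \<in> mat_vanish w"
  shows "tangent_vec A p \<in> mat_vanish (w + l)"
proof (cases p)
  case (fields u v \<delta>)
  then have *: "u \<in> mat_vanish l" "v \<in> mat_vanish l" "\<delta> \<in> aut_params l"
    using assms by (auto simp: params_def gl_params_subset)
  show ?thesis
    unfolding fields tangent_vec.simps
    using mat_vanish_mult[OF *(1) assms(2)] mat_vanish_mult[OF assms(2) *(2)]
      deriv_mat_vanish[OF *(3) assms(2)]
    by (intro mat_vanish_add) (simp_all add: add.commute)
qed

lemma scale_mult_left: "mat_scale a u ** A = mat_scale a (u ** A)"
  by (simp add: matrix_matrix_mult_def vec_eq_iff sum_distrib_left mult.assoc)

lemma scale_mult_right: "A ** mat_scale a v = mat_scale a (A ** v)"
  by (simp add: matrix_matrix_mult_def vec_eq_iff sum_distrib_left mult.left_commute)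

lemma deriv_mat_scale: "deriv_mat (\<chi> \<nu>. a * d $ \<nu>) A = mat_scale a (deriv_mat d A)"
  by (simp add: deriv_mat_def deriv_along_def vec_eq_iff sum_distrib_left mult.assoc)

text \<open>The tangent map is linear over the power series ring, so a scalar of order
  \<open>l\<close> raises the level by \<open>l\<close>.\<close>

lemma tangent_vec_scale:
  assumes "p \<in> params G l'" "a \<in> vanish l"
  shows "mat_scale a (tangent_vec A p) \<in> tangent_vec A ` params G (l + l')"
proof (cases p)
  case (fields u v \<delta>)
  have "mat_scale a (tangent_vec A p) = tangent_vec A (mat_scale a u, mat_scale a v, \<chi> \<nu>. a * \<delta> $ \<nu>)"
    by (simp add: fields mat_mod.scale_right_distrib scale_mult_left scale_mult_right deriv_mat_scale)
  moreover have "(mat_scale a u, mat_scale a v, \<chi> \<nu>. a * \<delta> $ \<nu>) \<in> params G (l + l')"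
    using assms by (auto simp: fields params_def gl_params_scale aut_params_scale)
  ultimately show ?thesis by (rule image_eqI)
qed

lemma tangent_vec_0 [simp]: "tangent_vec A 0 = 0"
  using tangent_vec_add[of A 0 0] by simp

lemma subspace_tangent_vec: "mat_mod.subspace (tangent_vec A ` params G l)"
  unfolding mat_mod.subspace_def
proof (intro conjI ballI allI)
  show "0 \<in> tangent_vec A ` params G l"
    by (rule image_eqI[of _ _ 0]) auto
  show "x + y \<in> tangent_vec A ` params G l"
    if "x \<in> tangent_vec A ` params G l" "y \<in> tangent_vec A ` params G l" for x y
  proof -
    from that obtain p q where "p \<in> params G l" "q \<in> params G l" "x = tangent_vec A p" "y = tangent_vec A q"
      by blast
    then show ?thesis by (intro image_eqI[of _ _ "p + q"]) (simp_all add: tangent_vec_add params_add)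
  qed
  show "mat_scale c x \<in> tangent_vec A ` params G l" if "x \<in> tangent_vec A ` params G l" for c x
    using that tangent_vec_scale[of _ G l c 0 A] by (auto simp del: tangent_vec.simps)
qed

lemma row_span_subset: "acts_left G \<Longrightarrow> row_span A \<subseteq> tangent_vec A ` params G 0"
  unfolding row_span_def
proof (intro mat_mod.span_minimal subspace_tangent_vec subsetI)
  fix X assume "acts_left G" "X \<in> {mat_unit p q ** A | p q. True}"
  then obtain p q where "X = tangent_vec A (mat_unit p q, 0, 0)"
    by (auto simp: deriv_mat_def deriv_along_def vec_eq_iff)
  then show "X \<in> tangent_vec A ` params G 0"
    by (rule image_eqI) (use \<open>acts_left G\<close> in \<open>simp add: params_def gl_params_def mat_vanish_def\<close>)
qed

lemma col_span_subset: "acts_right G \<Longrightarrow> col_span A \<subseteq> tangent_vec A ` params G 0"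
  unfolding col_span_def
proof (intro mat_mod.span_minimal subspace_tangent_vec subsetI)
  fix X assume "acts_right G" "X \<in> {A ** mat_unit h l | h l. True}"
  then obtain h l where "X = tangent_vec A (0, mat_unit h l, 0)"
    by (auto simp: deriv_mat_def deriv_along_def vec_eq_iff)
  then show "X \<in> tangent_vec A ` params G 0"
    by (rule image_eqI) (use \<open>acts_right G\<close> in \<open>simp add: params_def gl_params_def mat_vanish_def\<close>)
qed

text \<open>The generators belong to the constant fields \<open>axis \<nu> 1\<close>, which lie in
  no \<open>aut_params l\<close>; hence the full range here. Multiplication by m then brings them to
  level 0.\<close>

lemma deriv_span_subset: "deriv_span A \<subseteq> range (\<lambda>\<delta>. deriv_mat \<delta> A)"
  unfolding deriv_span_def
proof (rule mat_mod.span_minimal)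
  show "mat_mod.subspace (range (\<lambda>\<delta>. deriv_mat \<delta> A))"
    unfolding mat_mod.subspace_def
    by (auto simp flip: deriv_mat_add deriv_mat_scale
        intro!: image_eqI[of 0 "\<lambda>\<delta>. deriv_mat \<delta> A" 0])
       (simp add: deriv_mat_def deriv_along_def vec_eq_iff)
  have "(\<chi> i j. mps_deriv \<nu> (A $ i $ j)) = deriv_mat (axis \<nu> 1) A" for \<nu>
    by (simp add: deriv_mat_def deriv_along_def vec_eq_iff axis_def if_distrib[where f = "\<lambda>x. x * _"]
        cong: if_cong)
  then show "{\<chi> i j. mps_deriv \<nu> (A $ i $ j) |\<nu>. True} \<subseteq> range (\<lambda>\<delta>. deriv_mat \<delta> A)"
    by auto
qed

lemma max_ideal_deriv_span_subset:
  "ideal_smult max_ideal (deriv_span A) \<subseteq> tangent_vec A ` params G 0"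
  unfolding ideal_smult_def
proof (intro mat_mod.span_minimal subspace_tangent_vec subsetI)
  fix X assume "X \<in> {mat_scale a X | a X. a \<in> max_ideal \<and> X \<in> deriv_span A}"
  then obtain a \<delta> where a: "a \<in> vanish 1" "X = mat_scale a (deriv_mat \<delta> A)"
    using deriv_span_subset by (fastforce simp: max_ideal_eq_vanish)
  then have "X = tangent_vec A (0, 0, \<chi> \<nu>. a * \<delta> $ \<nu>)"
    by (simp add: deriv_mat_scale)
  moreover have "(0, 0, \<chi> \<nu>. a * \<delta> $ \<nu>) \<in> params G 0"
    using vanish_times[of a 1 _ 0] a by (auto simp: params_def aut_params_def)
  ultimately show "X \<in> tangent_vec A ` params G 0" by (rule image_eqI)
qed

lemma tangent_image_subset: "tangent_image G A \<subseteq> tangent_vec A ` params G 0"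
proof -
  note add = mat_mod.subspace_add[OF subspace_tangent_vec]
  show ?thesis
    using row_span_subset[of G A] col_span_subset[of G A] max_ideal_deriv_span_subset[of A G]
    by (cases G) (auto simp: acts_left_def acts_right_def set_plus_def intro!: add)
qed

lemma max_ideal_tangent_image_subset:
  "ideal_smult max_ideal (tangent_image G A) \<subseteq> tangent_vec A ` params G 1"
  unfolding ideal_smult_def
proof (intro mat_mod.span_minimal subspace_tangent_vec subsetI)
  fix X assume "X \<in> {mat_scale a X | a X. a \<in> max_ideal \<and> X \<in> tangent_image G A}"
  then obtain a p where "a \<in> vanish 1" "p \<in> params G 0" "X = mat_scale a (tangent_vec A p)"
    using tangent_image_subset by (fastforce simp: max_ideal_eq_vanish)
  then show "X \<in> tangent_vec A ` params G 1"
    using tangent_vec_scale[of p G 0 a 1 A] by simp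
qed

text \<open>The hypothesis is multiplied by powers of m: each variable split off raises the order on
  the left and the level on the right by one.\<close>

lemma mat_vanish_subset_tangent:
  fixes A :: "('k::comm_ring_1, 's::finite) mps ^ 'n ^ 'm"
  assumes "mat_vanish m \<subseteq> tangent_vec A ` params G 1"
  shows "mat_vanish (l + m) \<subseteq> tangent_vec A ` params G (l + 1)"
proof (induction l)
  case 0
  then show ?case using assms by simp
next
  case (Suc l)
  show ?case
  proof
    fix R :: "('k, 's) mps ^ 'n ^ 'm" assume R: "R \<in> mat_vanish (Suc l + m)"
    \<comment> \<open>Pairs of indices allow one choice of decompositions for all entries; the
      series \<open>g (i, j) \<nu>\<close> then form the matrix that multiplies the variable
      \<open>\<nu>\<close>.\<close>
    have "\<forall>ij. \<exists>g. (\<forall>\<nu>. g \<nu> \<in> vanish (l + m)) \<and>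
        R $ fst ij $ snd ij = (\<Sum>\<nu>\<in>UNIV. mps_monom (axis \<nu> 1) * g \<nu>)"
    proof
      fix ij
      have "R $ fst ij $ snd ij \<in> vanish (Suc (l + m))" using mat_vanishD[OF R] by simp
      then show "\<exists>g. (\<forall>\<nu>. g \<nu> \<in> vanish (l + m)) \<and>
          R $ fst ij $ snd ij = (\<Sum>\<nu>\<in>UNIV. mps_monom (axis \<nu> 1) * g \<nu>)"
        by (rule vanish_Suc_decomp) blast
    qed
    from choice[OF this] obtain g where
      g: "\<forall>ij. (\<forall>\<nu>. g ij \<nu> \<in> vanish (l + m)) \<and>
        R $ fst ij $ snd ij = (\<Sum>\<nu>\<in>UNIV. mps_monom (axis \<nu> 1) * g ij \<nu>)" ..
    have R_eq: "R $ i $ j = (\<Sum>\<nu>\<in>UNIV. mps_monom (axis \<nu> 1) * g (i, j) \<nu>)" for i j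
      using g[rule_format, of "(i, j)"] by simp
    have "R = (\<Sum>\<nu>\<in>UNIV. mat_scale (mps_monom (axis \<nu> 1)) (\<chi> i j. g (i, j) \<nu>))"
      by (simp add: vec_eq_iff R_eq)
    also have "\<dots> \<in> tangent_vec A ` params G (Suc l + 1)"
    proof (intro mat_mod.subspace_sum subspace_tangent_vec)
      fix \<nu>
      have "(\<chi> i j. g (i, j) \<nu>) \<in> tangent_vec A ` params G (l + 1)"
        using g by (intro subsetD[OF Suc]) (simp add: mat_vanish_def)
      then show "mat_scale (mps_monom (axis \<nu> 1)) (\<chi> i j. g (i, j) \<nu>) \<in> tangent_vec A ` params G (Suc l + 1)"
        using tangent_vec_scale[of _ G "l + 1" "mps_monom (axis \<nu> 1)" 1 A] by (auto simp: monom_vanish simp del: tangent_vec.simps)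
    qed
    finally show "R \<in> tangent_vec A ` params G (Suc l + 1)" .
  qed
qed

section \<open>Successive approximation\<close>

text \<open>Here \<open>P\<close> stands for the transformed matrix, \<open>Q\<close> for its change
  and \<open>D\<close> for the linear part of \<open>Q\<close>. Apart from \<open>Q - D\<close>,
  each summand contains two small factors among \<open>u\<close>, \<open>v\<close>,
  \<open>u'\<close>, \<open>v'\<close>, \<open>P - A\<close>, \<open>Q\<close>.\<close>

lemma mat_perturb_expand:
  fixes P Q A D :: "'a::comm_ring_1 ^ 'n ^ 'm"
  shows "(mat 1 + (u + u')) ** (P + Q) ** (mat 1 + (v + v')) - (mat 1 + u) ** P ** (mat 1 + v)
      - (u' ** A + A ** v' + D)
    = (Q - D) + u ** Q ** (mat 1 + v) + Q ** v + u' ** (P - A) ** (mat 1 + v) + u' ** A ** v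
      + u ** P ** v' + (P - A) ** v' + u' ** Q ** (mat 1 + v) + (mat 1 + u) ** Q ** v'
      + u' ** P ** v' + u' ** Q ** v'"
  by (simp add: matrix_add_ldistrib matrix_add_rdistrib matrix_diff_ldistrib matrix_diff_rdistrib
      matrix_mul_assoc algebra_simps)

text \<open>In each product of \<open>mat_perturb_expand\<close> one small factor contributes a + j
  and another at least a, while the matrix \<open>A\<close> behind it contributes w;
  \<open>Q - D\<close> is estimated by \<open>subst_taylor\<close>.\<close>

lemma act_linearization:
  fixes A :: "('k::comm_ring_1, 's::finite) mps ^ 'n ^ 'm"
  assumes A: "A \<in> mat_vanish w" and p: "p \<in> params G a" and q: "q \<in> params G (a + j)"
  shows "act A (p + q) - act A p - tangent_vec A q \<in> mat_vanish (w + (2 * a + j))"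
proof -
  obtain u v d where p_eq: "p = (u, v, d)" by (cases p)
  obtain u' v' \<delta> where q_eq: "q = (u', v', \<delta>)" by (cases q)
  have uv: "u \<in> mat_vanish a" "v \<in> mat_vanish a" "u' \<in> mat_vanish (a + j)" "v' \<in> mat_vanish (a + j)"
    and \<delta>: "\<delta> \<in> aut_params (a + j)"
    using p q by (auto simp: p_eq q_eq params_def gl_params_subset)
  have d': "d $ \<nu> \<in> vanish (1 + a)" "\<delta> $ \<nu> \<in> vanish (1 + (a + j))" for \<nu>
    using p q by (simp_all add: p_eq q_eq params_def aut_params_def)
  define P where "P = mat_subst (mps_subst (shift (($) d))) A"
  define Q where "Q = mat_subst (mps_subst (shift (($) (d + \<delta>)))) A - P"
  define D where "D = deriv_mat \<delta> A"
  have P: "P \<in> mat_vanish w"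
    using A by (simp add: P_def mat_subst_def mat_vanish_def subst_vanish)
  have PA: "P - A \<in> mat_vanish (w + a)"
    using A subst_shift[of "($) d" a, OF d'(1)] by (simp add: P_def mat_subst_def mat_vanish_def)
  have QD: "Q - D \<in> mat_vanish (w + (2 * a + j))"
    using A subst_taylor[of "($) d" a "($) \<delta>" j, OF d']
    by (simp add: Q_def P_def D_def deriv_mat_def mat_subst_def mat_vanish_def)
  have "D \<in> mat_vanish (w + (a + j))"
    unfolding D_def by (intro deriv_mat_vanish \<delta> A)
  from mat_vanish_add[OF mat_vanish_mono[OF QD] this] have Q: "Q \<in> mat_vanish (w + (a + j))" by simp
  note terms = mat_vanish_mult_right[OF mat_vanish_mult[OF uv(1) Q]] mat_vanish_mult[OF Q uv(2)]
    mat_vanish_mult_right[OF mat_vanish_mult[OF uv(3) PA]]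
    mat_vanish_mult[OF mat_vanish_mult[OF uv(3) A] uv(2)]
    mat_vanish_mult[OF mat_vanish_mult[OF uv(1) P] uv(4)] mat_vanish_mult[OF PA uv(4)]
    mat_vanish_mult_right[OF mat_vanish_mult[OF uv(3) Q]]
    mat_vanish_mult[OF mat_vanish_mult_left[OF Q] uv(4)]
    mat_vanish_mult[OF mat_vanish_mult[OF uv(3) P] uv(4)]
    mat_vanish_mult[OF mat_vanish_mult[OF uv(3) Q] uv(4)]
  have "act A (p + q) - act A p - tangent_vec A q
      = (mat 1 + (u + u')) ** (P + Q) ** (mat 1 + (v + v')) - (mat 1 + u) ** P ** (mat 1 + v)
        - (u' ** A + A ** v' + D)"
    by (simp add: p_eq q_eq P_def Q_def D_def)
  also have "\<dots> \<in> mat_vanish (w + (2 * a + j))"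
    unfolding mat_perturb_expand by (intro mat_vanish_add QD terms[THEN mat_vanish_mono]) simp_all
  finally show ?thesis .
qed

lemma act_0 [simp]: "act A 0 = A"
proof -
  have "(\<lambda>\<nu>. 0 $ \<nu>) = (\<lambda>_ :: 'b. 0 :: ('a, 'b) mps)" by simp
  then show ?thesis
    by (simp add: zero_prod_def mat_subst_def subst_shift_0[simplified] vec_eq_iff)
qed

text \<open>Level 1 puts \<open>u\<close> and \<open>v\<close> into m and \<open>d\<close> into
  order 2, as needed for invertibility. A missing factor contributes
  \<open>mat 1 + 0\<close>.\<close>

lemma act_in_orbit:
  assumes "p \<in> params G 1"
  shows "act A p \<in> orbit G A"
proof (cases p)
  case (fields u v d)
  have inv: "invertible (mat 1 + u)" "invertible (mat 1 + v)"
    using assms by (auto simp: fields params_def gl_params_subset intro!: invertible_one_plus)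
  have aut: "mps_subst (shift (($) d)) \<in> mps_Aut"
    using assms by (intro subst_shift_Aut) (simp add: fields params_def aut_params_def)
  have "acts_left G \<or> u = 0" "acts_right G \<or> v = 0"
    using assms by (auto simp: fields params_def gl_params_def split: if_splits)
  then show ?thesis
    using inv aut by (cases G) (auto simp: fields acts_left_def acts_right_def)
qed

text \<open>
  Newton's iteration, simplified: each error is corrected by solving the tangent equation at \<open>A\<close>
  itself and not at the current approximation, so that neither inverses nor compositions of group
  elements occur.
\<close>

lemma act_surjective:
  fixes A B :: "('k::comm_ring_1, 's::finite) mps ^ 'n ^ 'm"
  assumes tangent: "mat_vanish (w + a) \<subseteq> tangent_vec A ` params G 1"
    and A: "A \<in> mat_vanish w" and a: "1 \<le> a" and B: "B - A \<in> mat_vanish (w + 2 * a - 1)"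
  obtains p where "p \<in> params G a" "act A p = B"
proof -
  define good where "good j p \<longleftrightarrow> p \<in> params G a \<and> B - act A p \<in> mat_vanish (w + 2 * a - 1 + j)" for j p
  have "\<exists>p. \<forall>j. good j (p j) \<and> p (Suc j) - p j \<in> params G (a + j)"
  proof (rule dependent_nat_choice)
    show "\<exists>p. good 0 p"
      using B by (intro exI[of _ 0]) (simp add: good_def)
    fix p j assume "good j p"
    then have p: "p \<in> params G a" and R: "B - act A p \<in> mat_vanish (w + 2 * a - 1 + j)"
      by (auto simp: good_def)
    \<comment> \<open>An error of this order is a tangent vector of level exactly a + j: the order w
      + a has level 1, and a - 1 + j further orders are available.\<close>
    have eq: "w + 2 * a - 1 + j = (a - 1 + j) + (w + a)" "a - 1 + j + 1 = a + j" using a by simp_all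
    have "B - act A p \<in> tangent_vec A ` params G (a + j)"
      using mat_vanish_subset_tangent[OF tangent, of "a - 1 + j"] R unfolding eq by (rule subsetD)
    then obtain q where q: "q \<in> params G (a + j)" "B - act A p = tangent_vec A q"
      by (elim imageE)
    have "- (act A (p + q) - act A p - tangent_vec A q) \<in> mat_vanish (w + (2 * a + j))"
      using mat_vanish_diff[OF mat_vanish_0 act_linearization[OF A p q(1)]] by simp
    moreover have "- (act A (p + q) - act A p - tangent_vec A q) = B - act A (p + q)"
      unfolding q(2)[symmetric] by simp
    \<comment> \<open>The error left by linearization is exactly one order better than before, which
      closes the iteration.\<close>
    moreover have "w + (2 * a + j) = w + 2 * a - 1 + Suc j" using a by simp
    ultimately have "B - act A (p + q) \<in> mat_vanish (w + 2 * a - 1 + Suc j)" by (simp only:)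
    then have "good (Suc j) (p + q)"
      using p params_mono[OF q(1), of a] by (simp add: good_def params_add)
    then show "\<exists>p'. good (Suc j) p' \<and> p' - p \<in> params G (a + j)"
      using q(1) by (intro exI[of _ "p + q"]) simp
  qed
  then obtain p where p: "\<And>j. good j (p j)" and step: "\<And>j. p (Suc j) - p j \<in> params G (a + j)"
    by blast
  from params_limit[of p, OF step] obtain p' where p': "\<And>j. p' - p j \<in> params G (a + j)" by blast
  have "p 0 + (p' - p 0) \<in> params G a"
    using p[of 0] p'[of 0] by (intro params_add) (auto simp: good_def)
  then have "p' \<in> params G a" by simp
  moreover have "B - act A p' = 0"
  proof (rule mat_vanish_all_eq_0)
    fix j
    have pj: "p j \<in> params G a" and Bj: "B - act A (p j) \<in> mat_vanish j"
      using p[of j] by (auto simp: good_def intro: mat_vanish_mono)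
    \<comment> \<open>Continuity of \<open>act A\<close> comes from the same linearization, with the
      tail \<open>p' - p j\<close> of level a + j as the increment.\<close>
    have "act A (p j + (p' - p j)) - act A (p j) - tangent_vec A (p' - p j) \<in> mat_vanish j"
      by (rule mat_vanish_mono[OF act_linearization[OF A pj p']]) simp
    moreover have "tangent_vec A (p' - p j) \<in> mat_vanish j"
      by (rule mat_vanish_mono[OF tangent_vec_vanish[OF p' A]]) simp
    ultimately have "act A p' - act A (p j) \<in> mat_vanish j"
      using mat_vanish_add by fastforce
    from mat_vanish_diff[OF Bj this] show "B - act A p' \<in> mat_vanish j" by simp
  qed
  ultimately show thesis using that by simp
qed

text \<open>Tested on the matrix whose entries are all the m-th power of one variable.\<close>

lemma mat_vanish_subset_le:
  assumes "(mat_vanish m :: (('k::comm_ring_1, 's::finite) mps ^ 'n ^ 'm) set) \<subseteq> mat_vanish l"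
  shows "l \<le> m"
proof -
  obtain \<nu> :: 's where True by blast
  have "(\<chi> i j. mps_monom (axis \<nu> m)) \<in> (mat_vanish m :: (('k, 's) mps ^ 'n ^ 'm) set)"
    by (simp add: mat_vanish_def monom_vanish)
  with assms have "(\<chi> i j. mps_monom (axis \<nu> m)) \<in> (mat_vanish l :: (('k, 's) mps ^ 'n ^ 'm) set)" by blast
  then show ?thesis by (simp add: mat_vanish_def monom_vanish)
qed

theorem theorem3p2:
  fixes A :: "('k::field, 's::finite) mps ^ 'n ^ 'm"
    and G :: action_group
    and k :: nat
  assumes "A \<in> ideal_smult max_ideal UNIV"
    and "ideal_smult (ideal_power max_ideal (k + 2)) UNIV
           \<subseteq> ideal_smult max_ideal (tangent_image G A)"
  shows "\<exists>d. enat d + mat_ord A = enat (2 * k + 2) \<and> determined G d A"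
proof -
  have tangent: "mat_vanish (k + 2) \<subseteq> tangent_vec A ` params G 1"
    using assms(2) max_ideal_tangent_image_subset[of G A]
    unfolding ideal_power_max_ideal ideal_smult_vanish_UNIV by blast
  \<comment> \<open>Tangent vectors of level 1 have order at least w + 1, so the hypothesis places
    m^(k+2) M inside m^(w+1) M.\<close>
  have order: "w + 1 \<le> k + 2" if "A \<in> mat_vanish w" for w
    using tangent tangent_vec_vanish[OF _ that] by (intro mat_vanish_subset_le) blast
  \<comment> \<open>The zero matrix lies in \<open>mat_vanish (k + 2)\<close>, which would give k +
    3 \<le> k + 2.\<close>
  then have "A \<noteq> 0" using order[of "k + 2"] by auto
  then obtain w where w: "mat_ord A = enat w" "A \<in> mat_vanish w" by (rule mat_ord_vanish)
  define a where "a = k + 2 - w"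
  have a: "w + a = k + 2" "1 \<le> a" using order[OF w(2)] by (auto simp: a_def)
  have "B \<in> orbit G A" if "B - A \<in> mat_vanish (2 * k + 2 - w + 1)" for B
  proof -
    \<comment> \<open>Since w \<le> k + 1, no subtraction is truncated; with a = k + 2 - w both
      sides are 2k + 3 - w.\<close>
    have "2 * k + 2 - w + 1 = w + 2 * a - 1" using a by linarith
    with that obtain p where p: "p \<in> params G a" "act A p = B"
      using act_surjective[of w a A G B] tangent w(2) a by metis
    then show ?thesis using act_in_orbit params_mono[OF p(1) a(2)] by metis
  qed
  then have "determined G (2 * k + 2 - w) A"
    unfolding determined_def ideal_power_max_ideal ideal_smult_vanish_UNIV by blast
  moreover have "enat (2 * k + 2 - w) + mat_ord A = enat (2 * k + 2)"
    using w(1) a by simp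
  ultimately show ?thesis by blast
qed

end
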